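(* Let $q$ be a prime power, $n\ge1$ and $\pi\vdash[n]$. Then $$\mathrm{SPl}_n(\chi^\pi):=\mathrm{SPl}_{U_n}(\chi^\pi)=\frac{1}{q^{\frac{n(n-1)}{2}}}\,\frac{(q-1)^{d(\pi)}\,q^{2\dim(\pi)-2d(\pi)}}{q^{\mathrm{crs}(\pi)}}.$$
   Context: Set partitions. $[n]=\{1,\dots,n\}$; $\pi\vdash[n]$ means that $\pi$ is a set partition of $[n]$. A pair $(i,j)$ with $i<j$ is an arc of $\pi$ if $i,j$ lie in the same block and no $k$ with $i<k<j$ lies in that block. $D(\pi)$ is the set of arcs, $d(\pi)=|D(\pi)|$, $\dim(\pi)=\sum_{(i,j)\in D(\pi)}(j-i)$, and $\mathrm{crs}(\pi)$ is the number of unordered pairs of arcs $\{(i,j),(k,l)\}\subseteq D(\pi)$ with $i<k<j<l$. A pair $(i,j)$, $1\le i<j\le n$, is $\pi$-regular if there is no $k<i$ with $(k,j)\in D(\pi)$ and no $l>j$ with $(i,l)\in D(\pi)$; $\mathrm{Reg}(\pi)$ is the set of $\pi$-regular pairs. $\mathrm{nst}_\pi(\sigma)=\sum_{(k,l)\in D(\sigma)}\#\{(i,j)\in D(\pi): i<k<l<j\}$. Supercharacter theory. A supercharacter theory of a finite group $G$ is a pair $(\mathrm{scl}(G),\mathrm{sch}(G))$ with $\mathrm{scl}(G)$ a set partition of $G$ and $\mathrm{sch}(G)$ an orthogonal set of nonzero characters with $|\mathrm{scl}(G)|=|\mathrm{sch}(G)|$, each $\chi\in\mathrm{sch}(G)$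 constant on each member of $\mathrm{scl}(G)$, and each irreducible character a constituent of exactly one $\chi\in\mathrm{sch}(G)$. Its superplancherel measure is $\mathrm{SPl}_G(\chi)=\frac{1}{|G|}\frac{\chi(1)^2}{\langle\chi,\chi\rangle}$, where $\langle\chi,\zeta\rangle=\frac1{|G|}\sum_{g}\chi(g)\overline{\zeta(g)}$. $U_n$ is the group of $n\times n$ upper unitriangular matrices over the field with $q$ elements. It is endowed with the supercharacter theory of Bergeron and Thiem, in which supercharacters $\chi^\pi$ and superclasses $\mathcal K_\sigma$ are both indexed by set partitions of $[n]$ (the partition with no arcs indexing the superclass $\{1\}$), with known values $\chi^\pi(\mathcal K_\sigma)=q^{\dim(\pi)-d(\pi)-\mathrm{nst}_\pi(\sigma)}(q-1)^{d(\pi)}\left(-\frac1{q-1}\right)^{|D(\pi)\cap D(\sigma)|}$ if $D(\sigma)\subseteq\mathrm{Reg}(\pi)$ and $0$ otherwise; it is also known that $\langle\chi^\pi,\chi^\pi\rangle=(q-1)^{d(\pi)}q^{\mathrm{crs}(\pi)}$. *)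

theory Defs
  imports
    Complex_Main
    "HOL-Library.Disjoint_Sets"
    "HOL-Algebra.Coset"
    "Jordan_Normal_Form.Matrix"
begin

section \<open>Set partitions of \<open>{1..n}\<close>\<close>

definition arcs :: "nat set set \<Rightarrow> (nat \<times> nat) set" where
  "arcs \<pi> = {(i, j). i < j \<and> (\<exists>B\<in>\<pi>. i \<in> B \<and> j \<in> B \<and> (\<forall>k. i < k \<and> k < j \<longrightarrow> k \<notin> B))}"

definition num_arcs :: "nat set set \<Rightarrow> nat" where
  "num_arcs \<pi> = card (arcs \<pi>)"

definition arc_dim :: "nat set set \<Rightarrow> nat" where
  "arc_dim \<pi> = (\<Sum>(i, j)\<in>arcs \<pi>. j - i)"

definition crs :: "nat set set \<Rightarrow> nat" where
  "crs \<pi> = card {{(i, j), (k, l)} | i j k l.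
                  (i, j) \<in> arcs \<pi> \<and> (k, l) \<in> arcs \<pi> \<and> i < k \<and> k < j \<and> j < l}"


section \<open>Superplancherel measure\<close>

definition char_inner :: "('g, 'r) monoid_scheme \<Rightarrow> ('g \<Rightarrow> complex) \<Rightarrow> ('g \<Rightarrow> complex) \<Rightarrow> complex" where
  "char_inner G \<chi> \<zeta> = 1 / of_nat (order G) * (\<Sum>g\<in>carrier G. \<chi> g * cnj (\<zeta> g))"

definition SPl :: "('g, 'r) monoid_scheme \<Rightarrow> ('g \<Rightarrow> complex) \<Rightarrow> complex" where
  "SPl G \<chi> = 1 / of_nat (order G) * ((\<chi> \<one>\<^bsub>G\<^esub>)\<^sup>2 / char_inner G \<chi> \<chi>)"


section \<open>Upper triangular matrix groups\<close>

definition borel_group :: "nat \<Rightarrow> 'a::field mat monoid" where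
  "borel_group n = \<lparr>carrier = {b \<in> carrier_mat n n. upper_triangular b \<and> (\<forall>i<n. b $$ (i, i) \<noteq> 0)},
                    monoid.mult = (*), one = 1\<^sub>m n\<rparr>"

definition unitri_group :: "nat \<Rightarrow> 'a::field mat monoid" where
  "unitri_group n = \<lparr>carrier = {u \<in> carrier_mat n n. upper_triangular u \<and> (\<forall>i<n. u $$ (i, i) = 1)},
                     monoid.mult = (*), one = 1\<^sub>m n\<rparr>"

definition strict_upper :: "nat \<Rightarrow> 'a::field mat set" where
  "strict_upper n = {X \<in> carrier_mat n n. upper_triangular X \<and> (\<forall>i<n. X $$ (i, i) = 0)}"


section \<open>The supercharacters of Bergeron and Thiem\<close>

text \<open>
  Write \<open>U\<close>, \<open>B\<close>, \<open>N\<close> for \<open>unitri_group n\<close>, \<open>borel_group n\<close>, \<open>strict_upper n\<close>, so that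
  \<open>U = 1 + N\<close>. The superclass of \<open>\<sigma>\<close> is \<open>1 + B e B\<close>, where \<open>e\<close> is the sum of the matrix
  units at the arcs of \<open>\<sigma>\<close>. Dually, \<open>B\<close> acts on the linear functionals on \<open>N\<close>, and the
  supercharacter of \<open>\<pi>\<close> is the character of the \<open>U\<close>-module with basis \<open>v \<mu>\<close>, for \<open>\<mu>\<close> in the
  left \<open>B\<close>-orbit of the functional that sums the entries at the arcs of \<open>\<pi>\<close>, and action
  \<open>u (v \<mu>) = \<theta> (\<mu> (inv u - 1)) v (u \<mu>)\<close>. Here \<open>\<theta>\<close> is any nontrivial character of the
  additive group of the field; because the orbit is taken under \<open>B\<close> and not only under \<open>U\<close>,
  the supercharacter does not depend on \<open>\<theta>\<close>. Its value at an element of the superclass of \<open>\<sigma>\<close> is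
  \<open>q ^ (dim \<pi> - d \<pi> - nst) * (q - 1) ^ d \<pi> * (- 1 / (q - 1)) ^ card (arcs \<pi> \<inter> arcs \<sigma>)\<close>,
  where \<open>nst\<close> counts the pairs of an arc of \<open>\<pi>\<close> and an arc of \<open>\<sigma>\<close> strictly nested in it,
  if all arcs of \<open>\<sigma>\<close> are \<open>\<pi>\<close>-regular, and \<open>0\<close> otherwise.
\<close>

definition nontrivial_additive_character :: "('a::field \<Rightarrow> complex) \<Rightarrow> bool" where
  "nontrivial_additive_character \<theta> \<longleftrightarrow>
     \<theta> 0 = 1 \<and> (\<forall>x y. \<theta> (x + y) = \<theta> x * \<theta> y) \<and> (\<exists>x. \<theta> x \<noteq> 1)"

text \<open>Matrix indices start at \<open>0\<close>, elements of set partitions at \<open>1\<close>.\<close>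

definition arc_functional :: "nat \<Rightarrow> nat set set \<Rightarrow> 'a::field mat \<Rightarrow> 'a" where
  "arc_functional n \<pi> = (\<lambda>X\<in>strict_upper n. \<Sum>(i, j)\<in>arcs \<pi>. X $$ (i - 1, j - 1))"

definition dual_action :: "nat \<Rightarrow> 'a::field mat \<Rightarrow> ('a mat \<Rightarrow> 'a) \<Rightarrow> ('a mat \<Rightarrow> 'a)" where
  "dual_action n b \<mu> = (\<lambda>X\<in>strict_upper n. \<mu> (inv\<^bsub>borel_group n\<^esub> b * X))"

definition arc_orbit :: "nat \<Rightarrow> nat set set \<Rightarrow> ('a::field mat \<Rightarrow> 'a) set" where
  "arc_orbit n \<pi> = (\<lambda>b. dual_action n b (arc_functional n \<pi>)) ` carrier (borel_group n)"

text \<open>The coefficient of \<open>v \<nu>\<close> in \<open>u (v \<mu>)\<close>.\<close>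

definition module_entry ::
    "('a::field \<Rightarrow> complex) \<Rightarrow> nat \<Rightarrow> 'a mat \<Rightarrow> ('a mat \<Rightarrow> 'a) \<Rightarrow> ('a mat \<Rightarrow> 'a) \<Rightarrow> complex" where
  "module_entry \<theta> n u \<nu> \<mu> =
     (if \<nu> = dual_action n u \<mu> then \<theta> (\<mu> (inv\<^bsub>unitri_group n\<^esub> u - 1\<^sub>m n)) else 0)"

definition supercharacter ::
    "('a::field \<Rightarrow> complex) \<Rightarrow> nat \<Rightarrow> nat set set \<Rightarrow> 'a mat \<Rightarrow> complex" where
  "supercharacter \<theta> n \<pi> u = (\<Sum>\<mu>\<in>arc_orbit n \<pi>. module_entry \<theta> n u \<mu> \<mu>)"

lemma ex_nontrivial_additive_character:
  "\<exists>\<theta> :: 'a::{finite, field} \<Rightarrow> complex. nontrivial_additive_character \<theta>"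
proof -
  define S where "S = {H :: 'a set. 0 \<in> H \<and> (\<forall>x\<in>H. \<forall>y\<in>H. x - y \<in> H) \<and> H \<noteq> UNIV}"
  have "finite S" by simp
  moreover have "{0} \<noteq> (UNIV :: 'a set)"
    by (metis UNIV_I singletonD zero_neq_one)
  then have "{0} \<in> S" unfolding S_def by simp
  ultimately obtain H where H: "H \<in> S" and max: "\<And>H'. H' \<in> S \<Longrightarrow> H \<subseteq> H' \<Longrightarrow> H = H'"
    using finite_has_maximal[of S] by blast
  have H0: "0 \<in> H" and Hd: "\<And>x y. x \<in> H \<Longrightarrow> y \<in> H \<Longrightarrow> x - y \<in> H" and HU: "H \<noteq> UNIV"
    using H unfolding S_def by auto
  have Hm: "- x \<in> H" if "x \<in> H" for x using Hd[OF H0 that] by simp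
  have Ha: "x + y \<in> H" if "x \<in> H" "y \<in> H" for x y using Hd[OF that(1) Hm[OF that(2)]] by simp
  obtain x where x: "x \<notin> H" using HU by blast
  define I where "I = (\<lambda>k::int. of_int k * x \<in> H)"
  have Id: "I (a - b)" if "I a" "I b" for a b
    using Hd that unfolding I_def by (simp add: left_diff_distrib)
  have In: "I (int c * a)" if "I a" for a c
  proof (induction c)
    case 0 then show ?case using H0 by (simp add: I_def)
  next
    case (Suc c)
    then show ?case using Ha that unfolding I_def by (simp add: algebra_simps)
  qed
  have Ii: "I (c * a)" if "I a" for a c
    using In[OF that, of "nat \<bar>c\<bar>"] Id[of 0 "\<bar>c\<bar> * a"] H0 by (cases "c \<ge> 0") (auto simp: I_def)
  have "\<exists>m>0. I (int m)"
  proof (intro exI conjI)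
    show "CHAR('a) > 0" by (rule finite_imp_CHAR_pos) simp
    show "I (int CHAR('a))" using H0 by (simp add: I_def)
  qed
  then obtain m where m: "m > 0" "I (int m)" and least: "\<And>k. k > 0 \<Longrightarrow> I (int k) \<Longrightarrow> m \<le> k"
    using LeastI_ex[of "\<lambda>m. m > 0 \<and> I (int m)"] Least_le[of "\<lambda>m. m > 0 \<and> I (int m)"] by blast
  have Im: "int m dvd k" if "I k" for k
  proof -
    have "I (k mod int m)" using Id[OF that Ii[OF m(2), of "k div int m"]]
      by (simp add: minus_div_mult_eq_mod)
    moreover have "0 \<le> k mod int m" "k mod int m < int m" using m by auto
    ultimately have "k mod int m = 0" using least[of "nat (k mod int m)"] by force
    then show ?thesis by auto
  qed
  have m2: "m \<ge> 2" using m x by (cases "m = 1") (auto simp: I_def)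
  have ex: "\<exists>k. y - of_int k * x \<in> H" for y
  proof -
    define H' where "H' = {y. \<exists>k::int. y - of_int k * x \<in> H}"
    have sub: "H \<subseteq> H'" unfolding H'_def by (auto intro: exI[of _ 0])
    have "y - z \<in> H'" if yz: "y \<in> H'" "z \<in> H'" for y z
    proof -
      obtain k l :: int where "y - of_int k * x \<in> H" "z - of_int l * x \<in> H"
        using yz unfolding H'_def by blast
      from Hd[OF this] have "y - z - of_int (k - l) * x \<in> H" by (simp add: algebra_simps)
      then show ?thesis unfolding H'_def by blast
    qed
    moreover have "x \<in> H'" unfolding H'_def using H0 by (auto intro: exI[of _ 1])
    ultimately have "H' = UNIV" using max[of H'] sub x H0 unfolding S_def by blast
    then show ?thesis unfolding H'_def by blast
  qed
  define k where "k = (\<lambda>y. SOME k::int. y - of_int k * x \<in> H)"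
  have k: "y - of_int (k y) * x \<in> H" for y unfolding k_def by (rule someI_ex[OF ex])
  define e where "e = (\<lambda>j::int. cis (2 * pi * of_int j / of_nat m))"
  have e_add: "e (i + j) = e i * e j" for i j
    by (simp add: e_def cis_mult distrib_left add_divide_distrib)
  have e_m: "e (int m * j) = 1" for j
    using m cis_multiple_2pi[of "of_int j"] by (simp add: e_def mult.assoc)
  have e_cong: "e i = e j" if ij: "I (i - j)" for i j
  proof -
    obtain c where "i = j + int m * c" using Im[OF ij] by (auto simp: dvd_def algebra_simps)
    then show ?thesis by (simp add: e_add e_m)
  qed
  have kI: "I (k y - j)" if "y - of_int j * x \<in> H" for y j
    using Hd[OF that k[of y]] by (simp add: I_def algebra_simps)
  have "e (k (y + z)) = e (k y) * e (k z)" for y z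
  proof -
    have "y + z - of_int (k y + k z) * x \<in> H"
      using Ha[OF k[of y] k[of z]] by (simp add: algebra_simps)
    then show ?thesis using e_cong[OF kI] e_add by metis
  qed
  moreover have "e (k 0) = 1" using e_cong[OF kI[of 0 0]] H0 by (simp add: e_def)
  moreover have "e (k x) \<noteq> 1"
  proof
    assume "e (k x) = 1"
    moreover have "e (k x) = e 1" using e_cong[OF kI[of x 1]] H0 by simp
    ultimately have "cis (2 * pi / of_nat m) = 1" by (simp add: e_def)
    then have "cos (2 * pi / of_nat m) = 1" by (metis cis.sel(1) one_complex.sel(1))
    then obtain c :: int where "2 * pi / real m = of_int c * 2 * pi"
      using cos_one_2pi_int by blast
    then have "1 = real m * of_int c" using m by (simp add: field_simps)
    then have "1 = int m * c"
      by (metis of_int_1 of_int_eq_iff of_int_mult of_int_of_nat_eq)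
    then have "int m dvd 1" by (metis dvd_triv_left)
    then show False using m2 by simp
  qed
  ultimately show ?thesis
    unfolding nontrivial_additive_character_def by (intro exI[of _ "\<lambda>y. e (k y)"]) blast
qed

end

theory Submission
  imports Defs "Jordan_Normal_Form.Determinant"
begin

text \<open>
  Let \<open>L\<close> be the arc functional and \<open>O\<close> its left \<open>B\<close>-orbit. Averaging \<open>\<theta> (\<mu> (X w))\<close> over \<open>w \<in> U\<close> gives
  \<open>\<theta> (\<mu> X)\<close> if \<open>\<mu>\<close> vanishes on \<open>X N\<close> and \<open>0\<close> otherwise, so the supercharacter at \<open>inv (1 + X)\<close> equals
  \<open>1 / |U|\<close> times the sum of \<open>\<theta> (\<mu> (X w))\<close> over \<open>\<mu> \<in> O\<close> and \<open>w \<in> U\<close>. By Parseval, its squared norm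
  counts the coincidences \<open>\<mu> (_ w) = \<mu>' (_ w')\<close>, and is \<open>|O| |S| / |U|\<close> where \<open>S\<close> is the set of
  \<open>v \<in> U\<close> with \<open>L (_ v) \<in> O\<close>. The degree is \<open>|O|\<close>, so the superplancherel measure is \<open>|O| / |S|\<close>.
  Both cardinalities can be read off from matrix entries: \<open>|O| = (q - 1) ^ d q ^ (dim - d)\<close>, and
  \<open>S\<close> is cut out of \<open>U\<close> by the vanishing of \<open>dim - d - crs\<close> entries above the diagonal.
\<close>

section \<open>Unitriangular and triangular matrices over a finite field\<close>

text \<open>A square matrix amounts to a function on index pairs, so independent choices of entries
  multiply. The counts of \<open>orbit\<close> and of \<open>right_stable\<close> both end in this
  product.\<close>

lemma card_mat_entries:
  "card {A \<in> carrier_mat n n. \<forall>ij\<in>{..<n} \<times> {..<n}. A $$ ij \<in> S ij}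
     = (\<Prod>ij\<in>{..<n} \<times> {..<n}. card (S ij))"
proof -
  let ?I = "{..<n} \<times> {..<n}"
  have "bij_betw (\<lambda>A. restrict (\<lambda>ij. A $$ ij) ?I)
          {A \<in> carrier_mat n n. \<forall>ij\<in>?I. A $$ ij \<in> S ij} (PiE ?I S)"
  proof (rule bij_betwI[where g = "\<lambda>f. mat n n f"])
    show "(\<lambda>A. restrict (\<lambda>ij. A $$ ij) ?I) \<in> {A \<in> carrier_mat n n. \<forall>ij\<in>?I. A $$ ij \<in> S ij} \<rightarrow> PiE ?I S"
      by (rule funcsetI) (simp add: PiE_iff)
    show "mat n n \<in> PiE ?I S \<rightarrow> {A \<in> carrier_mat n n. \<forall>ij\<in>?I. A $$ ij \<in> S ij}"
      by (auto simp: PiE_iff)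
    show "mat n n (restrict (\<lambda>ij. A $$ ij) ?I) = A"
      if "A \<in> {A \<in> carrier_mat n n. \<forall>ij\<in>?I. A $$ ij \<in> S ij}" for A
      using that by auto
    show "restrict (\<lambda>ij. mat n n f $$ ij) ?I = f" if "f \<in> PiE ?I S" for f
      using that by (auto simp: fun_eq_iff PiE_iff extensional_def restrict_def)
  qed
  then show ?thesis
    by (simp add: bij_betw_same_card card_PiE)
qed

lemma finite_carrier_mat: "finite (carrier_mat n n :: 'a::finite mat set)"
proof (rule card_ge_0_finite)
  show "card (carrier_mat n n :: 'a mat set) > 0"
    using card_mat_entries[of n "\<lambda>_. UNIV :: 'a set"] by (simp add: finite_UNIV_card_ge_0)
qed

lemma index_mult_mat_sum:
  assumes "A \<in> carrier_mat n n" "B \<in> carrier_mat n n" "i < n" "j < n"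
  shows "(A * B) $$ (i, j) = (\<Sum>k<n. A $$ (i, k) * B $$ (k, j))"
  using assms by (simp add: scalar_prod_def atLeast0LessThan)

text \<open>A nonzero term at \<open>k\<close> needs \<open>i \<le> k\<close> and
  \<open>k \<le> j\<close>, so on and below the diagonal only \<open>k = i = j\<close> can
  survive.\<close>

lemma index_mult_upper_triangular:
  assumes "A \<in> carrier_mat n n" "B \<in> carrier_mat n n" "upper_triangular A" "upper_triangular B"
    and "i < n" "j \<le> i"
  shows "(A * B) $$ (i, j) = (if i = j then A $$ (i, i) * B $$ (i, i) else 0 :: 'a::semiring_0)"
proof -
  have j: "j < n" using assms by simp
  have "(A * B) $$ (i, j) = (\<Sum>k<n. if k = i then (if i = j then A $$ (i, i) * B $$ (i, i) else 0) else 0)"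
    unfolding index_mult_mat_sum[OF assms(1,2,5) j]
  proof (intro sum.cong refl)
    fix k assume "k \<in> {..<n}"
    then show "A $$ (i, k) * B $$ (k, j)
        = (if k = i then (if i = j then A $$ (i, i) * B $$ (i, i) else 0) else 0)"
      using assms upper_triangularD[OF assms(3), of k i] upper_triangularD[OF assms(4), of j k]
      by (cases "k < i"; cases "i < k") (auto simp: le_less)
  qed
  also have "\<dots> = (if i = j then A $$ (i, i) * B $$ (i, i) else 0)"
    using assms by simp
  finally show ?thesis .
qed

section \<open>The unitriangular and Borel groups and their action on strictly upper triangular
  matrices\<close>

abbreviation U :: "nat \<Rightarrow> 'a::field mat set" where "U n \<equiv> carrier (unitri_group n)"
abbreviation B :: "nat \<Rightarrow> 'a::field mat set" where "B n \<equiv> carrier (borel_group n)"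

lemma unitri_iff: "u \<in> U n \<longleftrightarrow> u \<in> carrier_mat n n \<and> upper_triangular u \<and> (\<forall>i<n. u $$ (i, i) = 1)"
  by (simp add: unitri_group_def)

lemma borel_iff: "b \<in> B n \<longleftrightarrow> b \<in> carrier_mat n n \<and> upper_triangular b \<and> (\<forall>i<n. b $$ (i, i) \<noteq> 0)"
  by (simp add: borel_group_def)

lemma strict_upper_iff:
  "X \<in> strict_upper n \<longleftrightarrow> X \<in> carrier_mat n n \<and> (\<forall>i<n. \<forall>j\<le>i. X $$ (i, j) = 0)"
  unfolding strict_upper_def
  by (auto simp: upper_triangular_def le_less)

lemma group_ops [simp]:
  "\<one>\<^bsub>borel_group n\<^esub> = 1\<^sub>m n" "x \<otimes>\<^bsub>borel_group n\<^esub> y = x * y"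
  "\<one>\<^bsub>unitri_group n\<^esub> = 1\<^sub>m n" "x \<otimes>\<^bsub>unitri_group n\<^esub> y = x * y"
  by (simp_all add: borel_group_def unitri_group_def)

lemma unitri_subset_borel: "U n \<subseteq> B n"
  by (auto simp: unitri_iff borel_iff)

lemma borel_carrier: "b \<in> B n \<Longrightarrow> b \<in> carrier_mat n n"
  by (simp add: borel_iff)

lemma unitri_carrier: "b \<in> U n \<Longrightarrow> b \<in> carrier_mat n n"
  by (simp add: unitri_iff)

lemma strict_upper_carrier: "X \<in> strict_upper n \<Longrightarrow> X \<in> carrier_mat n n"
  by (simp add: strict_upper_iff)

lemma borel_mult: "a \<in> B n \<Longrightarrow> b \<in> B n \<Longrightarrow> a * b \<in> B n"
  unfolding borel_iff by (auto simp: index_mult_upper_triangular simp del: index_mult_mat(1))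

lemma unitri_mult: "a \<in> U n \<Longrightarrow> b \<in> U n \<Longrightarrow> a * b \<in> U n"
  unfolding unitri_iff by (auto simp: index_mult_upper_triangular simp del: index_mult_mat(1))

lemma borel_mult_strict_upper: "b \<in> B n \<Longrightarrow> X \<in> strict_upper n \<Longrightarrow> b * X \<in> strict_upper n"
  unfolding borel_iff strict_upper_iff
  by (auto simp: index_mult_upper_triangular upper_triangular_def simp del: index_mult_mat(1))

lemma strict_upper_mult_borel: "b \<in> B n \<Longrightarrow> X \<in> strict_upper n \<Longrightarrow> X * b \<in> strict_upper n"
  unfolding borel_iff strict_upper_iff
  by (auto simp: index_mult_upper_triangular upper_triangular_def simp del: index_mult_mat(1))

lemma one_in_unitri: "1\<^sub>m n \<in> U n"
  by (auto simp: unitri_iff)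

lemma one_plus_strict_upper: "X \<in> strict_upper n \<Longrightarrow> 1\<^sub>m n + X \<in> U n"
  by (auto simp: unitri_iff strict_upper_iff upper_triangular_def)

lemma unitri_minus_one: "u \<in> U n \<Longrightarrow> u - 1\<^sub>m n \<in> strict_upper n"
  by (auto simp: unitri_iff strict_upper_iff upper_triangular_def le_less intro!: minus_carrier_mat)

lemma one_plus_minus_one:
  "X \<in> strict_upper n \<Longrightarrow> 1\<^sub>m n + X - 1\<^sub>m n = X"
  "u \<in> U n \<Longrightarrow> 1\<^sub>m n + (u - 1\<^sub>m n) = u"
  by (auto simp: strict_upper_iff unitri_iff)

lemma bij_one_plus: "bij_betw (\<lambda>X. 1\<^sub>m n + X) (strict_upper n) (U n)"
  by (rule bij_betwI[where g = "\<lambda>u. u - 1\<^sub>m n"])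
    (auto simp: one_plus_minus_one intro: one_plus_strict_upper unitri_minus_one)

lemma bij_unitri_minus_one: "bij_betw (\<lambda>u. u - 1\<^sub>m n) (U n) (strict_upper n)"
  by (rule bij_betwI[where g = "\<lambda>X. 1\<^sub>m n + X"])
    (auto simp: one_plus_minus_one intro: one_plus_strict_upper unitri_minus_one)

lemma finite_unitri: "finite (U n :: 'a::{finite,field} mat set)"
  by (rule finite_subset[OF _ finite_carrier_mat]) (auto simp: unitri_iff)

lemma finite_borel: "finite (B n :: 'a::{finite,field} mat set)"
  by (rule finite_subset[OF _ finite_carrier_mat]) (auto simp: borel_iff)

text \<open>Right multiplication by \<open>x\<close> is injective because \<open>x\<close> is
  invertible as a matrix, hence it permutes the finite set \<open>C\<close>, and the preimage of the
  identity is an inverse inside \<open>C\<close>. This avoids a separate proof that inverses of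
  triangular matrices are triangular.\<close>

lemma group_of_finite_submonoid:
  assumes G: "G = \<lparr>carrier = C, monoid.mult = (*), one = 1\<^sub>m n\<rparr>"
    and C: "finite C" "C \<subseteq> B n" "1\<^sub>m n \<in> C" "\<And>a b. a \<in> C \<Longrightarrow> b \<in> C \<Longrightarrow> a * b \<in> C"
  shows "group (G :: 'a::field mat monoid)"
proof (rule groupI)
  have mat: "x \<in> carrier_mat n n" if "x \<in> C" for x
    using that C(2) borel_carrier by blast
  show "\<one>\<^bsub>G\<^esub> \<in> carrier G" by (simp add: G C)
  fix x assume x: "x \<in> carrier G"
  then show "\<one>\<^bsub>G\<^esub> \<otimes>\<^bsub>G\<^esub> x = x" by (simp add: G left_mult_one_mat[OF mat])
  have xB: "x \<in> B n" using x C(2) by (auto simp: G)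
  have "det x \<noteq> 0"
    using xB upper_triangular_imp_det_eq_0_iff[of x n]
    by (auto simp: borel_iff diag_mat_def)
  \<comment> \<open>\<open>y\<close> is an inverse among all matrices and serves only to cancel
    \<open>x\<close>; membership in \<open>C\<close> is not known for it at this point.\<close>
  then obtain y where y: "y \<in> carrier_mat n n" "x * y = 1\<^sub>m n"
    using det_non_zero_imp_unit[of x n] xB
    by (auto simp: borel_iff Units_def ring_mat_def)
  have inj: "inj_on (\<lambda>z. z * x) C"
  proof (rule inj_onI)
    fix a b assume ab: "a \<in> C" "b \<in> C" "a * x = b * x"
    have "a = a * x * y"
      using y mat[OF ab(1)] borel_carrier[OF xB] by (simp add: assoc_mult_mat[of a n n x n y n])
    also have "\<dots> = b * x * y" using ab by simp
    also have "\<dots> = b"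
      using y mat[OF ab(2)] borel_carrier[OF xB] by (simp add: assoc_mult_mat[of b n n x n y n])
    finally show "a = b" .
  qed
  have "(\<lambda>z. z * x) ` C = C"
    by (rule endo_inj_surj[OF C(1) _ inj]) (use x C(4) in \<open>auto simp: G\<close>)
  then obtain z where "z \<in> C" "z * x = 1\<^sub>m n" using C(3) by (metis (no_types, lifting) image_iff)
  then show "\<exists>y\<in>carrier G. y \<otimes>\<^bsub>G\<^esub> x = \<one>\<^bsub>G\<^esub>" by (auto simp: G)
next
  have mat: "x \<in> carrier_mat n n" if "x \<in> C" for x
    using that C(2) borel_carrier by blast
  show "x \<otimes>\<^bsub>G\<^esub> y \<otimes>\<^bsub>G\<^esub> z = x \<otimes>\<^bsub>G\<^esub> (y \<otimes>\<^bsub>G\<^esub> z)"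
    if "x \<in> carrier G" "y \<in> carrier G" "z \<in> carrier G" for x y z
    using that by (simp add: G mat assoc_mult_mat[of _ n n _ n _ n])
qed (auto simp: G C)

lemma group_borel: "group (borel_group n :: 'a::{finite,field} mat monoid)"
proof (rule group_of_finite_submonoid)
  show "borel_group n = \<lparr>carrier = B n, monoid.mult = (*), one = 1\<^sub>m n :: 'a mat\<rparr>"
    by (simp add: borel_group_def)
qed (use unitri_subset_borel one_in_unitri in \<open>auto intro: finite_borel borel_mult\<close>)

lemma group_unitri: "group (unitri_group n :: 'a::{finite,field} mat monoid)"
proof (rule group_of_finite_submonoid)
  show "unitri_group n = \<lparr>carrier = U n, monoid.mult = (*), one = 1\<^sub>m n :: 'a mat\<rparr>"
    by (simp add: unitri_group_def)
qed (use unitri_subset_borel in \<open>auto intro: finite_unitri unitri_mult one_in_unitri\<close>)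

text \<open>\<open>dual_action\<close> inverts in the Borel group, \<open>module_entry\<close> in
  the unitriangular group; the two have to be reconciled.\<close>

lemma inv_borel_eq_inv_unitri:
  assumes "u \<in> U n"
  shows "inv\<^bsub>borel_group n\<^esub> u = inv\<^bsub>unitri_group n\<^esub> (u :: 'a::{finite,field} mat)"
proof (rule group.inv_equality[OF group_borel])
  show "inv\<^bsub>unitri_group n\<^esub> u \<otimes>\<^bsub>borel_group n\<^esub> u = \<one>\<^bsub>borel_group n\<^esub>"
    using group.l_inv[OF group_unitri assms] by simp
qed (use group.inv_closed[OF group_unitri assms] assms unitri_subset_borel in auto)

section \<open>Linear functionals on strictly upper triangular matrices\<close>

text \<open>Functionals are handled through coefficient arrays: left multiplication of the argument
  by \<open>b\<close> replaces \<open>p\<close> by the transpose of \<open>b\<close> times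
  \<open>p\<close>, right multiplication by \<open>v\<close> replaces it by \<open>p\<close> times
  the transpose of \<open>v\<close>.\<close>

definition pairing :: "nat \<Rightarrow> (nat \<Rightarrow> nat \<Rightarrow> 'a) \<Rightarrow> 'a::field mat \<Rightarrow> 'a" where
  "pairing n p X = (\<Sum>k<n. \<Sum>l<n. p k l * X $$ (k, l))"

lemma pairing_add:
  "X \<in> carrier_mat n n \<Longrightarrow> Y \<in> carrier_mat n n \<Longrightarrow> pairing n p (X + Y) = pairing n p X + pairing n p Y"
  by (simp add: pairing_def distrib_left sum.distrib)

lemma pairing_smult:
  "X \<in> carrier_mat n n \<Longrightarrow> pairing n p (c \<cdot>\<^sub>m X) = c * pairing n p X"
  by (simp add: pairing_def sum_distrib_left algebra_simps)

lemma pairing_diff: "pairing n (\<lambda>k l. p k l - p' k l) X = pairing n p X - pairing n p' X"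
  by (simp add: pairing_def left_diff_distrib sum_subtractf)

lemma pairing_mult_left:
  assumes "b \<in> carrier_mat n n" "X \<in> carrier_mat n n"
  shows "pairing n p (b * X) = pairing n (\<lambda>k l. \<Sum>i<n. b $$ (i, k) * p i l) X"
proof -
  have "pairing n p (b * X) = (\<Sum>i<n. \<Sum>l<n. \<Sum>k<n. b $$ (i, k) * p i l * X $$ (k, l))"
    using assms unfolding pairing_def
    by (intro sum.cong refl) (simp add: index_mult_mat_sum sum_distrib_left algebra_simps del: index_mult_mat(1))
  also have "\<dots> = (\<Sum>l<n. \<Sum>i<n. \<Sum>k<n. b $$ (i, k) * p i l * X $$ (k, l))"
    by (rule sum.swap)
  also have "\<dots> = (\<Sum>l<n. \<Sum>k<n. \<Sum>i<n. b $$ (i, k) * p i l * X $$ (k, l))"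
    by (intro sum.cong refl sum.swap)
  also have "\<dots> = pairing n (\<lambda>k l. \<Sum>i<n. b $$ (i, k) * p i l) X"
    unfolding pairing_def sum_distrib_right by (rule sum.swap)
  finally show ?thesis .
qed

lemma pairing_mult_right:
  assumes "v \<in> carrier_mat n n" "X \<in> carrier_mat n n"
  shows "pairing n p (X * v) = pairing n (\<lambda>k l. \<Sum>j<n. p k j * v $$ (l, j)) X"
proof -
  have "pairing n p (X * v) = (\<Sum>k<n. \<Sum>j<n. \<Sum>l<n. p k j * v $$ (l, j) * X $$ (k, l))"
    using assms unfolding pairing_def
    by (intro sum.cong refl) (simp add: index_mult_mat_sum sum_distrib_left algebra_simps del: index_mult_mat(1))
  also have "\<dots> = pairing n (\<lambda>k l. \<Sum>j<n. p k j * v $$ (l, j)) X"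
    unfolding pairing_def sum_distrib_right by (intro sum.cong refl sum.swap)
  finally show ?thesis .
qed

text \<open>Matrix units above the diagonal lie in \<open>strict_upper n\<close> and read off single
  coefficients. The other coefficients are invisible, since they meet zero entries of
  \<open>X\<close>.\<close>

lemma pairing_eq_iff:
  "(\<forall>X\<in>strict_upper n. pairing n p X = pairing n p' X) \<longleftrightarrow> (\<forall>l<n. \<forall>k<l. p k l = p' k l)"
proof (intro iffI allI impI ballI)
  fix l k assume eq: "\<forall>X\<in>strict_upper n. pairing n p X = pairing n p' X" and kl: "l < n" "k < l"
  let ?E = "mat n n (\<lambda>ij. of_bool (ij = (k, l))) :: 'a mat"
  have "?E \<in> strict_upper n" using kl by (auto simp: strict_upper_iff)
  moreover have "pairing n f ?E = f k l" for f
  proof -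
    have "pairing n f ?E = (\<Sum>i<n. if i = k then \<Sum>j<n. if j = l then f k l else 0 else 0)"
      unfolding pairing_def by (intro sum.cong refl) (auto intro!: sum.cong sum.neutral)
    then show ?thesis using kl by simp
  qed
  ultimately show "p k l = p' k l" using eq by metis
next
  fix X :: "'a mat" assume eq: "\<forall>l<n. \<forall>k<l. p k l = p' k l" and X: "X \<in> strict_upper n"
  show "pairing n p X = pairing n p' X"
    unfolding pairing_def
  proof (intro sum.cong refl)
    fix k l assume "k \<in> {..<n}" "l \<in> {..<n}"
    then show "p k l * X $$ (k, l) = p' k l * X $$ (k, l)"
      using eq X by (cases "k < l") (auto simp: strict_upper_iff)
  qed
qed

section \<open>Orthogonality of additive characters and Parseval\<close>

lemma strict_upper_add: "X \<in> strict_upper n \<Longrightarrow> Y \<in> strict_upper n \<Longrightarrow> X + Y \<in> strict_upper n"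
  by (auto simp: strict_upper_iff)

lemma strict_upper_smult: "X \<in> strict_upper n \<Longrightarrow> c \<cdot>\<^sub>m X \<in> strict_upper n"
  by (auto simp: strict_upper_iff)

lemma strict_upper_diff: "X \<in> strict_upper n \<Longrightarrow> Y \<in> strict_upper n \<Longrightarrow> X - Y \<in> strict_upper n"
  by (auto simp: strict_upper_iff intro: minus_carrier_mat)

text \<open>A nonzero functional takes every value, so some \<open>Y\<close> has value
  \<open>x\<close> with \<open>\<theta> x \<noteq> 1\<close>. Translating the summation by
  \<open>Y\<close> multiplies the sum by \<open>\<theta> x\<close>, which forces it to be
  zero.\<close>

lemma sum_character_pairing:
  fixes \<theta> :: "'a::{finite,field} \<Rightarrow> complex"
  assumes \<theta>: "nontrivial_additive_character \<theta>"
  shows "(\<Sum>X\<in>strict_upper n. \<theta> (pairing n p X))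
    = (if \<forall>X\<in>strict_upper n. pairing n p X = 0 then of_nat (card (strict_upper n :: 'a mat set)) else 0)"
proof (cases "\<forall>X\<in>strict_upper n. pairing n p X = 0")
  case True
  then show ?thesis using \<theta> by (simp add: nontrivial_additive_character_def)
next
  case False
  then obtain X where X: "X \<in> strict_upper n" "pairing n p X \<noteq> 0" by blast
  obtain x where x: "\<theta> x \<noteq> 1" using \<theta> by (auto simp: nontrivial_additive_character_def)
  define Y where "Y = (x / pairing n p X) \<cdot>\<^sub>m X"
  have Y: "Y \<in> strict_upper n" "pairing n p Y = x"
    using X by (auto simp: Y_def strict_upper_smult pairing_smult strict_upper_carrier)
  have "bij_betw (\<lambda>X. Y + X) (strict_upper n) (strict_upper n)"
  proof (rule bij_betwI[where g = "\<lambda>X. X - Y"])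
    show "Y + X - Y = X" if "X \<in> strict_upper n" for X
      using that Y by (auto simp: strict_upper_iff)
    show "Y + (X - Y) = X" if "X \<in> strict_upper n" for X
      using that Y by (auto simp: strict_upper_iff)
  qed (use Y in \<open>auto intro: strict_upper_add strict_upper_diff\<close>)
  then have "(\<Sum>X\<in>strict_upper n. \<theta> (pairing n p X)) = (\<Sum>X\<in>strict_upper n. \<theta> (pairing n p (Y + X)))"
    by (rule sum.reindex_bij_betw[symmetric])
  also have "\<dots> = (\<Sum>X\<in>strict_upper n. \<theta> x * \<theta> (pairing n p X))"
    using Y \<theta> by (intro sum.cong refl)
      (simp add: pairing_add strict_upper_carrier nontrivial_additive_character_def)
  also have "\<dots> = \<theta> x * (\<Sum>X\<in>strict_upper n. \<theta> (pairing n p X))"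
    by (simp add: sum_distrib_left)
  finally have "(\<Sum>X\<in>strict_upper n. \<theta> (pairing n p X)) = 0" using x by simp
  then show ?thesis using False by (simp only: if_False)
qed

text \<open>\<open>\<theta> x\<close> is a root of unity of order dividing the characteristic, hence
  of modulus one, and both sides are its inverse.\<close>

lemma cnj_additive_character:
  fixes \<theta> :: "'a::{finite,field} \<Rightarrow> complex"
  assumes \<theta>: "nontrivial_additive_character \<theta>"
  shows "cnj (\<theta> x) = \<theta> (- x)"
proof -
  have pow: "\<theta> (of_nat m * x) = \<theta> x ^ m" for m
    using \<theta> by (induction m) (simp_all add: nontrivial_additive_character_def distrib_right)
  have pos: "CHAR('a) > 0" by (rule finite_imp_CHAR_pos) simp
  have "\<theta> x ^ CHAR('a) = 1"
    using pow[of "CHAR('a)"] \<theta> by (simp add: nontrivial_additive_character_def)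
  then have "norm (\<theta> x) ^ CHAR('a) = 1" by (metis norm_power norm_one)
  then have "norm (\<theta> x) = 1" 
    using pos power_eq_imp_eq_base[of "norm (\<theta> x)" "CHAR('a)" 1] by simp
  then have "\<theta> x * cnj (\<theta> x) = 1" by (simp add: complex_norm_square[symmetric])
  moreover have "\<theta> x * \<theta> (- x) = 1"
    using \<theta> by (metis add.right_inverse nontrivial_additive_character_def)
  ultimately show ?thesis by (metis mult_cancel_left mult_zero_left zero_neq_one)
qed

text \<open>Parseval: after expanding the square, orthogonality applied to the difference of two
  functionals keeps the pairs that agree on \<open>strict_upper n\<close>. Distinct indices may
  carry the same functional, so index pairs are counted.\<close>

lemma sum_norm_character_sum:
  fixes \<theta> :: "'a::{finite,field} \<Rightarrow> complex" and f :: "'i \<Rightarrow> 'a mat \<Rightarrow> 'a"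
  assumes \<theta>: "nontrivial_additive_character \<theta>" and fin: "finite I"
    and f: "\<And>i X. i \<in> I \<Longrightarrow> X \<in> strict_upper n \<Longrightarrow> f i X = pairing n (p i) X"
  shows "(\<Sum>X\<in>strict_upper n. (\<Sum>i\<in>I. \<theta> (f i X)) * cnj (\<Sum>i\<in>I. \<theta> (f i X)))
    = of_nat (card (strict_upper n :: 'a mat set)) *
      of_nat (card {(i, j) \<in> I \<times> I. \<forall>X\<in>strict_upper n. f i X = f j X})"
proof -
  let ?N = "strict_upper n :: 'a mat set"
  have "(\<Sum>X\<in>?N. (\<Sum>i\<in>I. \<theta> (f i X)) * cnj (\<Sum>i\<in>I. \<theta> (f i X)))
      = (\<Sum>X\<in>?N. \<Sum>(i, j)\<in>I \<times> I. \<theta> (pairing n (\<lambda>k l. p i k l - p j k l) X))"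
  proof (intro sum.cong refl)
    fix X :: "'a mat" assume X: "X \<in> ?N"
    have "\<theta> (f i X) * cnj (\<theta> (f j X)) = \<theta> (pairing n (\<lambda>k l. p i k l - p j k l) X)"
      if "i \<in> I" "j \<in> I" for i j
    proof -
      have "\<theta> (f i X) * cnj (\<theta> (f j X)) = \<theta> (f i X + - f j X)"
        using \<theta> by (simp only: cnj_additive_character[OF \<theta>] nontrivial_additive_character_def)
      then show ?thesis using that X by (simp add: pairing_diff f)
    qed
    then show "(\<Sum>i\<in>I. \<theta> (f i X)) * cnj (\<Sum>i\<in>I. \<theta> (f i X))
        = (\<Sum>(i, j)\<in>I \<times> I. \<theta> (pairing n (\<lambda>k l. p i k l - p j k l) X))"
      by (simp add: cnj_sum sum_product sum.cartesian_product)
  qed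
  also have "\<dots> = (\<Sum>(i, j)\<in>I \<times> I. \<Sum>X\<in>?N. \<theta> (pairing n (\<lambda>k l. p i k l - p j k l) X))"
    by (subst sum.swap) (simp add: case_prod_beta)
  also have "\<dots> = (\<Sum>ij\<in>I \<times> I. if \<forall>X\<in>?N. f (fst ij) X = f (snd ij) X then of_nat (card ?N) else 0)"
  proof (intro sum.cong refl)
    fix ij assume "ij \<in> I \<times> I"
    then have "(\<forall>X\<in>?N. pairing n (\<lambda>k l. p (fst ij) k l - p (snd ij) k l) X = 0)
        \<longleftrightarrow> (\<forall>X\<in>?N. f (fst ij) X = f (snd ij) X)"
      by (auto simp: pairing_diff f)
    then show "(case ij of (i, j) \<Rightarrow> \<Sum>X\<in>?N. \<theta> (pairing n (\<lambda>k l. p i k l - p j k l) X))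
        = (if \<forall>X\<in>?N. f (fst ij) X = f (snd ij) X then of_nat (card ?N) else 0)"
      unfolding case_prod_beta sum_character_pairing[OF \<theta>] by simp
  qed
  also have "\<dots> = of_nat (card ?N) * of_nat (card {ij \<in> I \<times> I. \<forall>X\<in>?N. f (fst ij) X = f (snd ij) X})"
    using fin by (simp add: sum.If_cases Int_def mult.commute)
  also have "{ij \<in> I \<times> I. \<forall>X\<in>?N. f (fst ij) X = f (snd ij) X}
      = {(i, j) \<in> I \<times> I. \<forall>X\<in>?N. f i X = f j X}"
    by auto
  finally show ?thesis .
qed

section \<open>The norm of an orbit character\<close>

text \<open>With \<open>w = 1 + Y\<close> and \<open>D = inv g - 1\<close> one has
  \<open>\<mu> (D * w) = \<mu> D + \<mu> (D * Y)\<close>. The sum over \<open>Y\<close> is zero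
  unless \<open>\<mu>\<close> vanishes at all \<open>D * Y\<close>, which says that \<open>g\<close>
  fixes \<open>\<mu>\<close>. So the fixed-point test of the trace becomes a character sum.\<close>

lemma character_term_eq:
  fixes \<theta> :: "'a::{finite,field} \<Rightarrow> complex"
  assumes \<theta>: "nontrivial_additive_character \<theta>" and g: "g \<in> U n"
    and \<mu>: "\<mu> = (\<lambda>X\<in>strict_upper n. pairing n p X)"
  shows "of_nat (card (strict_upper n :: 'a mat set)) * module_entry \<theta> n g \<mu> \<mu>
    = (\<Sum>w\<in>U n. \<theta> (\<mu> ((inv\<^bsub>unitri_group n\<^esub> g - 1\<^sub>m n) * w)))"
proof -
  let ?N = "strict_upper n :: 'a mat set"
  define u where "u = inv\<^bsub>unitri_group n\<^esub> g"
  have u: "u \<in> U n" unfolding u_def by (rule group.inv_closed[OF group_unitri g])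
  define D where "D = u - 1\<^sub>m n"
  have D: "D \<in> ?N" unfolding D_def by (rule unitri_minus_one[OF u])
  have Dc: "D \<in> carrier_mat n n" by (rule strict_upper_carrier[OF D])
  have DN: "D * Y \<in> ?N" if "Y \<in> ?N" for Y
  proof -
    have "D * Y = u * Y - Y"
      using that u by (simp add: D_def minus_mult_distrib_mat[of u n n _ Y n] unitri_carrier strict_upper_carrier
          left_mult_one_mat[OF strict_upper_carrier])
    moreover have "u * Y \<in> ?N"
      using that u unitri_subset_borel by (intro borel_mult_strict_upper) auto
    ultimately show ?thesis using that by (simp add: strict_upper_diff)
  qed
  \<comment> \<open>Since \<open>u * X = X + D * X\<close>, the functionals
    \<open>dual_action n g \<mu>\<close> and \<open>\<mu>\<close> differ at \<open>X\<close> by the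
    value at \<open>D * X\<close>.\<close>
  have fixed: "\<mu> = dual_action n g \<mu> \<longleftrightarrow> (\<forall>Y\<in>?N. pairing n p (D * Y) = 0)"
  proof -
    have "dual_action n g \<mu> = (\<lambda>X\<in>?N. pairing n p X + pairing n p (D * X))"
      unfolding dual_action_def inv_borel_eq_inv_unitri[OF g] u_def[symmetric]
    proof (rule restrict_ext)
      fix X :: "'a mat" assume X: "X \<in> ?N"
      have "u * X \<in> ?N" using X u unitri_subset_borel by (intro borel_mult_strict_upper) auto
      moreover have "u * X = X + D * X"
        using X u by (auto simp: D_def minus_mult_distrib_mat[of u n n _ X n] dest!: unitri_carrier strict_upper_carrier)
      ultimately show "\<mu> (u * X) = pairing n p X + pairing n p (D * X)"
        using pairing_add[OF strict_upper_carrier[OF X] strict_upper_carrier[OF DN[OF X]], of p]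
        by (simp add: \<mu>)
    qed
    then show ?thesis unfolding \<mu> by (auto simp: fun_eq_iff restrict_def split: if_splits)
  qed
  have "(\<Sum>w\<in>U n. \<theta> (\<mu> (D * w))) = (\<Sum>Y\<in>?N. \<theta> (\<mu> (D * (1\<^sub>m n + Y))))"
    by (rule sum.reindex_bij_betw[OF bij_one_plus, symmetric])
  also have "\<dots> = (\<Sum>Y\<in>?N. \<theta> (\<mu> D) * \<theta> (pairing n (\<lambda>k l. \<Sum>i<n. D $$ (i, k) * p i l) Y))"
  proof (intro sum.cong refl)
    fix Y :: "'a mat" assume Y: "Y \<in> ?N"
    have "D * (1\<^sub>m n + Y) = D + D * Y"
      using mult_add_distrib_mat[OF Dc one_carrier_mat strict_upper_carrier[OF Y]] Dc by simp
    moreover have "D + D * Y \<in> ?N" by (rule strict_upper_add[OF D DN[OF Y]])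
    ultimately have "\<mu> (D * (1\<^sub>m n + Y)) = \<mu> D + pairing n p (D * Y)"
      using D pairing_add[OF Dc strict_upper_carrier[OF DN[OF Y]], of p] by (simp add: \<mu>)
    then show "\<theta> (\<mu> (D * (1\<^sub>m n + Y)))
        = \<theta> (\<mu> D) * \<theta> (pairing n (\<lambda>k l. \<Sum>i<n. D $$ (i, k) * p i l) Y)"
      using \<theta> by (simp add: pairing_mult_left[OF Dc strict_upper_carrier[OF Y]] nontrivial_additive_character_def)
  qed
  also have "\<dots> = \<theta> (\<mu> D) * (if \<mu> = dual_action n g \<mu> then of_nat (card ?N) else 0)"
    unfolding fixed sum_distrib_left[symmetric] sum_character_pairing[OF \<theta>]
    by (simp add: pairing_mult_left[OF Dc] strict_upper_carrier)
  also have "\<dots> = of_nat (card ?N) * module_entry \<theta> n g \<mu> \<mu>"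
    unfolding module_entry_def D_def u_def by simp
  finally show ?thesis unfolding D_def u_def by simp
qed

section \<open>Left orbits of a functional and their right twists\<close>

locale pairing_orbit =
  fixes n :: nat and p :: "nat \<Rightarrow> nat \<Rightarrow> 'a::{finite,field}"
begin

definition orbit :: "('a mat \<Rightarrow> 'a) set" where
  "orbit = (\<lambda>c. \<lambda>X\<in>strict_upper n. pairing n p (c * X)) ` B n"

text \<open>This is the set \<open>S\<close> of the opening comment, for an arbitrary coefficient
  array \<open>p\<close> in place of \<open>L\<close>.\<close>

definition right_stable :: "'a mat set" where
  "right_stable = {v \<in> U n. \<exists>c\<in>B n. \<forall>X\<in>strict_upper n. pairing n p (X * v) = pairing n p (c * X)}"

lemma finite_orbit: "finite orbit"
  unfolding orbit_def by (intro finite_imageI finite_borel)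

lemma orbit_pairing:
  assumes "\<mu> \<in> orbit"
  shows "\<exists>p'. \<mu> = (\<lambda>X\<in>strict_upper n. pairing n p' X)"
proof -
  obtain c where c: "c \<in> B n" "\<mu> = (\<lambda>X\<in>strict_upper n. pairing n p (c * X))"
    using assms by (auto simp: orbit_def)
  then have "\<mu> = (\<lambda>X\<in>strict_upper n. pairing n (\<lambda>k l. \<Sum>i<n. c $$ (i, k) * p i l) X)"
    by (auto simp: pairing_mult_left borel_carrier strict_upper_carrier intro!: restrict_ext)
  then show ?thesis by blast
qed

lemma borel_inv:
  assumes "b \<in> (B n :: 'a mat set)"
  shows "\<exists>b'\<in>B n. b' * b = 1\<^sub>m n \<and> b * b' = 1\<^sub>m n"
  using group.l_inv[OF group_borel assms] group.r_inv[OF group_borel assms]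
    group.inv_closed[OF group_borel assms] by auto

text \<open>The two-sided actions commute and \<open>B\<close> is transitive on the orbit, so whether twisting by \<open>v\<close>
  preserves the orbit can be tested at a single point.\<close>

lemma right_twist_in_orbit_iff:
  assumes "\<mu> \<in> orbit" "v \<in> U n"
  shows "(\<lambda>X\<in>strict_upper n. \<mu> (X * v)) \<in> orbit \<longleftrightarrow> v \<in> right_stable"
proof -
  let ?N = "strict_upper n :: 'a mat set"
  obtain b where b: "b \<in> B n" "\<mu> = (\<lambda>X\<in>?N. pairing n p (b * X))"
    using assms by (auto simp: orbit_def)
  obtain b' where b': "b' \<in> B n" "b' * b = 1\<^sub>m n" "b * b' = 1\<^sub>m n" using borel_inv[OF b(1)] by blast
  have vB: "v \<in> B n" using assms unitri_subset_borel by blast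
  note mats = borel_carrier[OF b(1)] borel_carrier[OF b'(1)] borel_carrier[OF vB]
  have tw: "(\<lambda>X\<in>?N. \<mu> (X * v)) = (\<lambda>X\<in>?N. pairing n p (b * X * v))"
    using vB mats by (auto simp: b(2) strict_upper_mult_borel strict_upper_carrier
        assoc_mult_mat[of _ n n _ n _ n] intro!: restrict_ext)
  show ?thesis
  proof
    assume "(\<lambda>X\<in>?N. \<mu> (X * v)) \<in> orbit"
    then obtain c where c: "c \<in> B n" "(\<lambda>X\<in>?N. pairing n p (b * X * v)) = (\<lambda>X\<in>?N. pairing n p (c * X))"
      unfolding tw orbit_def by blast
    \<comment> \<open>Evaluation at \<open>b' * X\<close> cancels \<open>b\<close> and leads back to
      the base functional.\<close>
    have "pairing n p (X * v) = pairing n p (c * b' * X)" if X: "X \<in> ?N" for X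
    proof -
      have X': "b' * X \<in> ?N" by (rule borel_mult_strict_upper[OF b'(1) X])
      have "pairing n p (b * (b' * X) * v) = pairing n p (c * (b' * X))"
        using fun_cong[OF c(2), of "b' * X"] X' by simp
      moreover have "b * (b' * X) = X"
        using assoc_mult_mat[OF mats(1,2) strict_upper_carrier[OF X]] b'(3) strict_upper_carrier[OF X] by simp
      ultimately show ?thesis
        using assoc_mult_mat[OF borel_carrier[OF c(1)] mats(2) strict_upper_carrier[OF X]] by simp
    qed
    then show "v \<in> right_stable"
      using assms borel_mult[OF c(1) b'(1)] by (auto simp: right_stable_def)
  next
    assume "v \<in> right_stable"
    then obtain c where c: "c \<in> B n" "\<And>X. X \<in> ?N \<Longrightarrow> pairing n p (X * v) = pairing n p (c * X)"
      by (auto simp: right_stable_def)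
    have "(\<lambda>X\<in>?N. \<mu> (X * v)) = (\<lambda>X\<in>?N. pairing n p (c * b * X))"
      unfolding tw
    proof (rule restrict_ext)
      fix X :: "'a mat" assume X: "X \<in> ?N"
      show "pairing n p (b * X * v) = pairing n p (c * b * X)"
        using c(2)[OF borel_mult_strict_upper[OF b(1) X]]
          assoc_mult_mat[OF borel_carrier[OF c(1)] mats(1) strict_upper_carrier[OF X]] by simp
    qed
    then show "(\<lambda>X\<in>?N. \<mu> (X * v)) \<in> orbit"
      unfolding orbit_def using borel_mult[OF c(1) b(1)] by blast
  qed
qed

text \<open>In a coincidence, \<open>\<mu>'\<close> is the twist of \<open>\<mu>\<close> by
  \<open>v = inv w' * w\<close>. So it amounts to a free choice of \<open>\<mu>\<close> and
  \<open>w'\<close> together with a \<open>v\<close> that keeps the twist in the orbit, that is,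
  \<open>v \<in> right_stable\<close>.\<close>

lemma card_coincidences:
  "card {((\<mu>, w), (\<mu>', w')) \<in> (orbit \<times> U n) \<times> (orbit \<times> U n). \<forall>X\<in>strict_upper n. \<mu> (X * w) = \<mu>' (X * w')}
    = card orbit * card (U n :: 'a mat set) * card right_stable" (is "card ?Q = _")
proof -
  let ?N = "strict_upper n :: 'a mat set"
  let ?inv = "\<lambda>w. inv\<^bsub>unitri_group n\<^esub> w :: 'a mat"
  have inv: "?inv w \<in> U n" "?inv w * w = 1\<^sub>m n" "w * ?inv w = 1\<^sub>m n" if "w \<in> U n" for w
    using group.inv_closed[OF group_unitri that] group.l_inv[OF group_unitri that]
      group.r_inv[OF group_unitri that] by auto
  have stable: "v \<in> U n" if "v \<in> right_stable" for v
    using that by (simp add: right_stable_def)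
  have assoc: "X * (v * w) = X * v * w" if "X \<in> carrier_mat n n" "v \<in> U n" "w \<in> U n" for X v w
    using that by (simp add: assoc_mult_mat[of _ n n _ n _ n] unitri_carrier)
  have NU: "X * w \<in> ?N" if "X \<in> ?N" "w \<in> U n" for X w
    using that unitri_subset_borel by (blast intro: strict_upper_mult_borel)
  have left_cancel: "?inv w * (w * v) = v" "w * (?inv w * v) = v" if "v \<in> U n" "w \<in> U n" for v w
    using that inv by (simp_all add: assoc unitri_carrier left_mult_one_mat[OF unitri_carrier])
  have right_cancel: "X * ?inv w * w = X" if "X \<in> ?N" "w \<in> U n" for X w
    using that inv assoc[of X "?inv w" w]
    by (simp add: strict_upper_carrier right_mult_one_mat[OF strict_upper_carrier])
  have ext: "(\<lambda>X\<in>?N. \<mu> X) = \<mu>" if "\<mu> \<in> orbit" for \<mu>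
    using that by (auto simp: orbit_def)
  have twist: "(\<lambda>X\<in>?N. \<mu> (X * (?inv w' * w))) = \<mu>'"
    if "\<mu> \<in> orbit" "w \<in> U n" "\<mu>' \<in> orbit" "w' \<in> U n" "\<forall>X\<in>?N. \<mu> (X * w) = \<mu>' (X * w')"
    for \<mu> w \<mu>' w'
  proof -
    have "\<mu> (X * (?inv w' * w)) = \<mu>' X" if X: "X \<in> ?N" for X
    proof -
      have "\<mu> (X * ?inv w' * w) = \<mu>' (X * ?inv w' * w')"
        using that(1) \<open>\<forall>X\<in>?N. \<mu> (X * w) = \<mu>' (X * w')\<close> NU[OF X inv(1)[OF \<open>w' \<in> U n\<close>]] by blast
      then show ?thesis
        using right_cancel[OF X \<open>w' \<in> U n\<close>]
          assoc[OF strict_upper_carrier[OF X] inv(1)[OF \<open>w' \<in> U n\<close>] \<open>w \<in> U n\<close>] by simp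
    qed
    then have "(\<lambda>X\<in>?N. \<mu> (X * (?inv w' * w))) = (\<lambda>X\<in>?N. \<mu>' X)" by (rule restrict_ext)
    then show ?thesis using ext \<open>\<mu>' \<in> orbit\<close> by simp
  qed
  have "bij_betw (\<lambda>((\<mu>, w'), v). ((\<mu>, w' * v), ((\<lambda>X\<in>?N. \<mu> (X * v)), w')))
      ((orbit \<times> U n) \<times> right_stable) ?Q"
  proof (rule bij_betwI[where g = "\<lambda>((\<mu>, w), (\<mu>', w')). ((\<mu>, w'), ?inv w' * w)"])
    show "(\<lambda>((\<mu>, w'), v). ((\<mu>, w' * v), ((\<lambda>X\<in>?N. \<mu> (X * v)), w'))) \<in> (orbit \<times> U n) \<times> right_stable \<rightarrow> ?Q"
    proof (rule funcsetI, clarify, intro conjI SigmaI ballI)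
      fix \<mu> and w' v X :: "'a mat" assume *: "\<mu> \<in> orbit" "w' \<in> U n" "v \<in> right_stable"
      show "w' * v \<in> U n" using * by (simp add: unitri_mult stable)
      show "(\<lambda>X\<in>?N. \<mu> (X * v)) \<in> orbit" using * by (simp add: right_twist_in_orbit_iff stable)
      assume "X \<in> ?N"
      then show "\<mu> (X * (w' * v)) = (\<lambda>X\<in>?N. \<mu> (X * v)) (X * w')"
        using * by (simp add: NU stable assoc strict_upper_carrier)
    qed
    show "(\<lambda>((\<mu>, w), (\<mu>', w')). ((\<mu>, w'), ?inv w' * w)) \<in> ?Q \<rightarrow> (orbit \<times> U n) \<times> right_stable"
    proof (rule funcsetI)
      fix y assume "y \<in> ?Q"
      then obtain \<mu> w \<mu>' w' where y: "y = ((\<mu>, w), (\<mu>', w'))"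
        and *: "\<mu> \<in> orbit" "w \<in> U n" "\<mu>' \<in> orbit" "w' \<in> U n" "\<forall>X\<in>?N. \<mu> (X * w) = \<mu>' (X * w')"
        by blast
      have v: "?inv w' * w \<in> U n" using * inv by (intro unitri_mult) auto
      have "?inv w' * w \<in> right_stable"
        using right_twist_in_orbit_iff[OF *(1) v] twist[OF *] *(3) by simp
      then show "(\<lambda>((\<mu>, w), (\<mu>', w')). ((\<mu>, w'), ?inv w' * w)) y \<in> (orbit \<times> U n) \<times> right_stable"
        using y * by simp
    qed
    show "(\<lambda>((\<mu>, w), (\<mu>', w')). ((\<mu>, w'), ?inv w' * w))
        ((\<lambda>((\<mu>, w'), v). ((\<mu>, w' * v), ((\<lambda>X\<in>?N. \<mu> (X * v)), w'))) x) = x"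
      if "x \<in> (orbit \<times> U n) \<times> right_stable" for x
      using that left_cancel stable by auto
    show "(\<lambda>((\<mu>, w'), v). ((\<mu>, w' * v), ((\<lambda>X\<in>?N. \<mu> (X * v)), w')))
        ((\<lambda>((\<mu>, w), (\<mu>', w')). ((\<mu>, w'), ?inv w' * w)) y) = y"
      if "y \<in> ?Q" for y
    proof -
      obtain \<mu> w \<mu>' w' where y: "y = ((\<mu>, w), (\<mu>', w'))" by (metis prod.exhaust)
      then show ?thesis using that twist[of \<mu> w \<mu>' w'] left_cancel(2)[of w w'] by simp
    qed
  qed
  then show ?thesis by (simp add: bij_betw_same_card[symmetric] card_cartesian_product)
qed

lemma strict_upper_card: "card (strict_upper n :: 'a mat set) = card (U n :: 'a mat set)"
  by (rule bij_betw_same_card[OF bij_one_plus])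

lemma SPl_orbit_character:
  assumes \<theta>: "nontrivial_additive_character \<theta>"
  shows "SPl (unitri_group n) (\<lambda>u. \<Sum>\<mu>\<in>orbit. module_entry \<theta> n u \<mu> \<mu>)
    = of_nat (card orbit) / of_nat (card right_stable)"
proof -
  let ?N = "strict_upper n :: 'a mat set" and ?G = "unitri_group n :: 'a mat monoid"
  let ?\<chi> = "\<lambda>u. \<Sum>\<mu>\<in>orbit. module_entry \<theta> n u \<mu> \<mu>"
  let ?I = "orbit \<times> (U n :: 'a mat set)"
  \<comment> \<open>\<open>h\<close> is the averaged form of the character: its value at
    \<open>inv g - 1\<close> is \<open>m\<close> times the character at \<open>g\<close>. It sums
    \<open>\<theta>\<close> over functionals indexed by pairs of \<open>\<mu>\<close> and
    \<open>w\<close>, so Parseval applies.\<close>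
  define h where "h X = (\<Sum>i\<in>?I. \<theta> ((fst i) (X * snd i)))" for X
  define m where "m = card (U n :: 'a mat set)"
  have m: "m > 0" using finite_unitri one_in_unitri unfolding m_def by (metis card_gt_0_iff empty_iff)
  obtain P where P: "\<mu> = (\<lambda>X\<in>?N. pairing n (P \<mu>) X)" if "\<mu> \<in> orbit" for \<mu>
    using orbit_pairing by metis
  have \<chi>: "of_nat m * ?\<chi> g = h (inv\<^bsub>?G\<^esub> g - 1\<^sub>m n)" if "g \<in> U n" for g
  proof -
    have "of_nat m * ?\<chi> g = (\<Sum>\<mu>\<in>orbit. \<Sum>w\<in>U n. \<theta> (\<mu> ((inv\<^bsub>?G\<^esub> g - 1\<^sub>m n) * w)))"
      unfolding sum_distrib_left m_def strict_upper_card[symmetric]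
      by (rule sum.cong[OF refl]) (rule character_term_eq[OF \<theta> that P])
    then show ?thesis by (simp add: h_def sum.cartesian_product case_prod_beta)
  qed
  have bij: "bij_betw (\<lambda>g. inv\<^bsub>?G\<^esub> g - 1\<^sub>m n) (U n) ?N"
  proof -
    have "bij_betw (\<lambda>g. inv\<^bsub>?G\<^esub> g) (U n) (U n)"
      by (rule bij_betwI[where g = "\<lambda>g. inv\<^bsub>?G\<^esub> g"])
        (auto simp: group.inv_inv[OF group_unitri] group.inv_closed[OF group_unitri])
    moreover have "bij_betw (\<lambda>u. u - 1\<^sub>m n) (U n) ?N"
      by (rule bij_unitri_minus_one)
    ultimately show ?thesis using bij_betw_trans[of _ "U n" "U n" _ ?N] by (auto simp: o_def)
  qed
  \<comment> \<open>As \<open>card (strict_upper n)\<close> is also \<open>m\<close>, Parseval and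
    the count of coincidences give \<open>m * (card orbit * m * card right_stable)\<close>, and
    \<open>m ^ 2\<close> cancels.\<close>
  have "of_nat m ^ 2 * (\<Sum>g\<in>U n. ?\<chi> g * cnj (?\<chi> g)) = (\<Sum>g\<in>U n. (of_nat m * ?\<chi> g) * cnj (of_nat m * ?\<chi> g))"
    by (simp add: sum_distrib_left power2_eq_square algebra_simps)
  also have "\<dots> = (\<Sum>g\<in>U n. h (inv\<^bsub>?G\<^esub> g - 1\<^sub>m n) * cnj (h (inv\<^bsub>?G\<^esub> g - 1\<^sub>m n)))"
    by (intro sum.cong refl) (simp only: \<chi>)
  also have "\<dots> = (\<Sum>X\<in>?N. h X * cnj (h X))"
    by (rule sum.reindex_bij_betw[OF bij])
  also have "\<dots> = of_nat (card ?N) *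
      of_nat (card {(i, j) \<in> ?I \<times> ?I. \<forall>X\<in>?N. (fst i) (X * snd i) = (fst j) (X * snd j)})"
    unfolding h_def
  proof (rule sum_norm_character_sum[OF \<theta>])
    show "finite ?I" by (simp add: finite_orbit finite_unitri)
    fix i X assume *: "i \<in> ?I" "X \<in> ?N"
    then have "X * snd i \<in> ?N"
      using subsetD[OF unitri_subset_borel, of "snd i"] by (intro strict_upper_mult_borel) auto
    moreover have "fst i = (\<lambda>X\<in>?N. pairing n (P (fst i)) X)" using * by (intro P) auto
    ultimately have "fst i (X * snd i) = pairing n (P (fst i)) (X * snd i)"
      by (metis restrict_apply')
    then show "fst i (X * snd i) = pairing n (\<lambda>k l. \<Sum>j<n. P (fst i) k j * snd i $$ (l, j)) X"
      using * pairing_mult_right[of "snd i" n X "P (fst i)"] strict_upper_carrier[of X n]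
        unitri_carrier[of "snd i" n] by auto
  qed
  also have "{(i, j) \<in> ?I \<times> ?I. \<forall>X\<in>?N. (fst i) (X * snd i) = (fst j) (X * snd j)}
      = {((\<mu>, w), (\<mu>', w')) \<in> ?I \<times> ?I. \<forall>X\<in>?N. \<mu> (X * w) = \<mu>' (X * w')}"
    by auto
  also have "card \<dots> = card orbit * m * card right_stable"
    unfolding card_coincidences m_def ..
  finally have "(\<Sum>g\<in>U n. ?\<chi> g * cnj (?\<chi> g)) = of_nat (card orbit) * of_nat (card right_stable)"
    using m by (simp add: strict_upper_card m_def[symmetric] power2_eq_square)
  then have inner: "char_inner ?G ?\<chi> ?\<chi> = of_nat (card orbit) * of_nat (card right_stable) / of_nat m"
    by (simp add: char_inner_def Coset.order_def m_def)
  \<comment> \<open>The identity fixes every basis vector with coefficient 1, so the degree is the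
    size of the orbit.\<close>
  have "module_entry \<theta> n (1\<^sub>m n) \<mu> \<mu> = 1" if "\<mu> \<in> orbit" for \<mu>
  proof -
    have inv1: "inv\<^bsub>?G\<^esub> (1\<^sub>m n) = 1\<^sub>m n"
      by (rule group.inv_equality[OF group_unitri]) (simp_all add: one_in_unitri)
    have "dual_action n (1\<^sub>m n) \<mu> = \<mu>"
      unfolding dual_action_def inv_borel_eq_inv_unitri[OF one_in_unitri] inv1
      using that by (auto simp: orbit_def left_mult_one_mat[OF strict_upper_carrier] intro!: restrict_ext)
    moreover have "\<mu> (1\<^sub>m n - 1\<^sub>m n) = 0"
    proof -
      have "1\<^sub>m n - 1\<^sub>m n \<in> ?N" by (rule unitri_minus_one[OF one_in_unitri])
      then have "\<mu> (1\<^sub>m n - 1\<^sub>m n) = pairing n (P \<mu>) (1\<^sub>m n - 1\<^sub>m n)"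
        using P[OF that] by (metis restrict_apply')
      then show ?thesis by (simp add: pairing_def)
    qed
    ultimately show ?thesis using \<theta> by (simp add: module_entry_def inv1 nontrivial_additive_character_def)
  qed
  then have one: "?\<chi> (1\<^sub>m n) = of_nat (card orbit)" by simp
  have "card orbit > 0" using finite_orbit one_in_unitri unitri_subset_borel
    by (auto simp: orbit_def card_gt_0_iff)
  then show ?thesis
    unfolding SPl_def inner group_ops one using m
    by (simp add: Coset.order_def m_def[symmetric] power2_eq_square)
qed

end

section \<open>Counting matrix entries of arc diagrams\<close>

lemma card_pairs_less: "card {(i, j). i < j \<and> j < n} = n * (n - 1) div 2"
proof -
  have "{(i, j). i < j \<and> j < n} = prod.swap ` (SIGMA j:{..<n}. {..<j})" by force
  then have "card {(i, j). i < j \<and> j < n} = card (SIGMA j:{..<n}. {..<j})"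
    by (simp add: card_image)
  also have "\<dots> = \<Sum>{0..<n}" by (simp add: atLeast0LessThan)
  finally show ?thesis by (simp add: Sum_Ico_nat)
qed

text \<open>The positions above the diagonal outside \<open>T\<close> are free, all others are
  forced. The factor for \<open>T\<close> on the left avoids a subtraction in the exponent.\<close>

lemma card_unitri_vanishing:
  assumes T: "T \<subseteq> {(i, j). i < j \<and> j < n}"
  shows "card {u \<in> (U n :: 'a::{finite,field} mat set). \<forall>ij\<in>T. u $$ ij = 0} * card (UNIV :: 'a set) ^ card T
    = card (UNIV :: 'a set) ^ (n * (n - 1) div 2)"
proof -
  let ?I = "{..<n} \<times> {..<n}" and ?L = "{(i, j). i < j \<and> j < n}"
  \<comment> \<open>The singleton holds the forced entry: 1 on the diagonal, 0 below it and on
    \<open>T\<close>, which lies above it.\<close>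
  define S :: "nat \<times> nat \<Rightarrow> 'a set"
    where "S ij = (if ij \<in> ?L - T then UNIV else {of_bool (fst ij = snd ij)})" for ij
  have fin: "finite ?L" by (rule finite_subset[of _ ?I]) auto
  have "{u \<in> (U n :: 'a mat set). \<forall>ij\<in>T. u $$ ij = 0}
      = {u \<in> carrier_mat n n. \<forall>ij\<in>?I. u $$ ij \<in> S ij}" (is "?V = ?M")
  proof (rule equalityI; rule subsetI)
    fix u assume "u \<in> ?V"
    then show "u \<in> ?M"
      by (auto simp: S_def unitri_iff upper_triangular_def not_less le_less)
  next
    fix u assume u: "u \<in> ?M"
    then have S: "u $$ (i, j) \<in> S (i, j)" if "i < n" "j < n" for i j using that by blast
    have "u $$ (i, j) = 0" if "j < i" "i < n" for i j using S[of i j] that by (simp add: S_def)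
    moreover have "u $$ (i, i) = 1" if "i < n" for i using S[of i i] that by (simp add: S_def)
    moreover have "u $$ (i, j) = 0" if "(i, j) \<in> T" for i j
      using S[of i j] that subsetD[OF T that] by (simp add: S_def)
    ultimately show "u \<in> ?V" using u by (auto simp: unitri_iff upper_triangular_def)
  qed
  then have "card ?V = (\<Prod>ij\<in>?I. card (S ij))" using card_mat_entries[of n S] by simp
  also have "\<dots> = (\<Prod>ij\<in>?L - T. card (UNIV :: 'a set))"
    by (rule prod.mono_neutral_cong_right) (auto simp: S_def)
  also have "\<dots> = card (UNIV :: 'a set) ^ card (?L - T)" by simp
  finally have "card ?V * card (UNIV :: 'a set) ^ card T = card (UNIV :: 'a set) ^ (card (?L - T) + card T)"
    by (simp add: power_add)
  also have "card (?L - T) + card T = n * (n - 1) div 2"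
    using card_Diff_subset[OF finite_subset[OF T fin] T] card_mono[OF fin T] card_pairs_less[of n] by simp
  finally show ?thesis .
qed

text \<open>The counts use of a set partition that no vertex starts two arcs and none ends two.
  Vertices start at 0 here, so that an arc is itself a matrix position.\<close>

locale arc_diagram =
  fixes n :: nat and A :: "(nat \<times> nat) set"
  assumes arc_less: "(i, j) \<in> A \<Longrightarrow> i < j"
    and arc_bound: "(i, j) \<in> A \<Longrightarrow> j < n"
    and right_unique: "(i, j) \<in> A \<Longrightarrow> (i, j') \<in> A \<Longrightarrow> j = j'"
    and left_unique: "(i, j) \<in> A \<Longrightarrow> (i', j) \<in> A \<Longrightarrow> i = i'"
begin

lemma finite_arcs: "finite A"
  by (rule finite_subset[of _ "{..<n} \<times> {..<n}"]) (auto dest: arc_bound less_trans[OF arc_less arc_bound])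

text \<open>The bound \<open>i\<close> of the sum is not the free \<open>i\<close> of the arc; by
  \<open>left_unique\<close> only the start of the arc ending at \<open>l\<close>
  contributes.\<close>

lemma sum_left_arc:
  assumes "(i, l) \<in> A"
  shows "(\<Sum>i<n. f i * of_bool ((i, l) \<in> A)) = (f i :: 'a::semiring_1)"
proof -
  have "(\<Sum>i'<n. f i' * of_bool ((i', l) \<in> A)) = (\<Sum>i'<n. if i' = i then f i else 0)"
    using assms left_unique by (intro sum.cong refl) auto
  then show ?thesis using arc_less[OF assms] arc_bound[OF assms] by simp
qed

lemma sum_right_arc:
  assumes "(k, j) \<in> A"
  shows "(\<Sum>j<n. of_bool ((k, j) \<in> A) * f j) = (f j :: 'a::semiring_1)"
proof -
  have "(\<Sum>j'<n. of_bool ((k, j') \<in> A) * f j') = (\<Sum>j'<n. if j' = j then f j else 0)"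
    using assms right_unique by (intro sum.cong refl) auto
  then show ?thesis using arc_bound[OF assms] by simp
qed

text \<open>For an arc \<open>(i, j)\<close>, the left translate by \<open>b\<close> has coefficient
  \<open>b $$ (i, k)\<close> at \<open>(k, j)\<close>. It is visible for \<open>k < j\<close> and
  can be nonzero for \<open>i \<le> k\<close>, so the slots are the entries of \<open>b\<close> that
  the translate remembers.\<close>

definition slots :: "(nat \<times> nat) set" where
  "slots = {(i, k). \<exists>j. (i, j) \<in> A \<and> i \<le> k \<and> k < j}"

lemma left_translate_eq_iff:
  fixes b c :: "'a::{finite,field} mat"
  assumes "b \<in> B n" "c \<in> B n"
  defines "p \<equiv> \<lambda>i j. of_bool ((i, j) \<in> A) :: 'a"
  shows "(\<lambda>X\<in>strict_upper n. pairing n p (b * X)) = (\<lambda>X\<in>strict_upper n. pairing n p (c * X))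
    \<longleftrightarrow> (\<forall>ik\<in>slots. b $$ ik = c $$ ik)"
proof -
  have "(\<lambda>X\<in>strict_upper n. pairing n p (b * X)) = (\<lambda>X\<in>strict_upper n. pairing n p (c * X))
      \<longleftrightarrow> (\<forall>X\<in>strict_upper n. pairing n p (b * X) = pairing n p (c * X))"
    by (auto simp: fun_eq_iff restrict_def split: if_splits)
  also have "\<dots> \<longleftrightarrow> (\<forall>l<n. \<forall>k<l. (\<Sum>i<n. b $$ (i, k) * p i l) = (\<Sum>i<n. c $$ (i, k) * p i l))"
    using assms(1,2)
    by (subst pairing_eq_iff[symmetric]) (simp add: pairing_mult_left borel_carrier strict_upper_carrier)
  also have "\<dots> \<longleftrightarrow> (\<forall>ik\<in>slots. b $$ ik = c $$ ik)"
  proof (intro iffI ballI allI impI)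
    fix ik assume eq: "\<forall>l<n. \<forall>k<l. (\<Sum>i<n. b $$ (i, k) * p i l) = (\<Sum>i<n. c $$ (i, k) * p i l)"
      and "ik \<in> slots"
    then obtain i k j where ik: "ik = (i, k)" "(i, j) \<in> A" "i \<le> k" "k < j" by (auto simp: slots_def)
    then show "b $$ ik = c $$ ik"
      using eq arc_bound[OF ik(2)] sum_left_arc[OF ik(2), of "\<lambda>i. b $$ (i, k)"]
        sum_left_arc[OF ik(2), of "\<lambda>i. c $$ (i, k)"] by (auto simp: p_def)
  next
    fix l k assume eq: "\<forall>ik\<in>slots. b $$ ik = c $$ ik" and kl: "l < n" "k < l"
    show "(\<Sum>i<n. b $$ (i, k) * p i l) = (\<Sum>i<n. c $$ (i, k) * p i l)"
    proof (intro sum.cong refl)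
      fix i assume i: "i \<in> {..<n}"
      show "b $$ (i, k) * p i l = c $$ (i, k) * p i l"
      \<comment> \<open>In the other case both sides are zero: there is no arc
        \<open>(i, l)\<close>, or \<open>(i, k)\<close> lies below the diagonal.\<close>
      proof (cases "(i, l) \<in> A \<and> i \<le> k")
        case True
        then have "(i, k) \<in> slots" using kl by (auto simp: slots_def)
        then show ?thesis using eq by auto
      next
        case False
        then show ?thesis using assms(1,2) i
          by (auto simp: p_def borel_iff upper_triangular_def not_le)
      qed
    qed
  qed
  finally show ?thesis .
qed

text \<open>By \<open>right_unique\<close>, different arcs have their slots in different rows. An
  arc \<open>(i, j)\<close> owns one diagonal slot and \<open>j - i - 1\<close> slots to the right
  of it.\<close>

lemma prod_slots:
  "(\<Prod>ik\<in>slots. f (fst ik = snd ik)) = f True ^ card A * f False ^ (\<Sum>(i, j)\<in>A. j - i - 1)"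
  for f :: "bool \<Rightarrow> 'b::comm_semiring_1"
proof -
  have "slots = (\<lambda>x. (fst (fst x), snd x)) ` (SIGMA ij:A. {fst ij..<snd ij})"
    by (force simp: slots_def)
  moreover have "inj_on (\<lambda>x. (fst (fst x), snd x)) (SIGMA ij:A. {fst ij..<snd ij})"
    by (auto simp: inj_on_def dest: right_unique)
  ultimately have "(\<Prod>ik\<in>slots. f (fst ik = snd ik)) = (\<Prod>(ij, k)\<in>(SIGMA ij:A. {fst ij..<snd ij}). f (fst ij = k))"
    by (simp add: prod.reindex case_prod_beta)
  also have "\<dots> = (\<Prod>ij\<in>A. \<Prod>k\<in>{fst ij..<snd ij}. f (fst ij = k))"
    by (rule prod.Sigma[symmetric]) (auto simp: finite_arcs)
  also have "\<dots> = (\<Prod>(i, j)\<in>A. f True * f False ^ (j - i - 1))"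
  proof (intro prod.cong refl)
    fix ij assume "ij \<in> A"
    then obtain i j where ij: "ij = (i, j)" "i < j" by (cases ij) (auto dest: arc_less)
    have "(\<Prod>k\<in>{i..<j}. f (i = k)) = f True * (\<Prod>k\<in>{Suc i..<j}. f (i = k))"
      using ij by (simp add: prod.atLeast_Suc_lessThan)
    also have "(\<Prod>k\<in>{Suc i..<j}. f (i = k)) = (\<Prod>k\<in>{Suc i..<j}. f False)"
      by (intro prod.cong refl) auto
    finally show "(\<Prod>k\<in>{fst ij..<snd ij}. f (fst ij = k)) = (case ij of (i, j) \<Rightarrow> f True * f False ^ (j - i - 1))"
      using ij by simp
  qed
  also have "\<dots> = f True ^ card A * f False ^ (\<Sum>(i, j)\<in>A. j - i - 1)"
    by (simp add: case_prod_beta prod.distrib power_sum)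
  finally show ?thesis .
qed

text \<open>Each translate has exactly one representative in \<open>M\<close>, the matrices that
  agree with the identity outside the slots. Diagonal slots take the nonzero field elements, the
  other slots take all.\<close>

lemma card_left_translates:
  defines "p \<equiv> \<lambda>i j. of_bool ((i, j) \<in> A) :: 'a::{finite,field}"
  shows "card ((\<lambda>c. \<lambda>X\<in>strict_upper n. pairing n p (c * X)) ` B n)
    = (card (UNIV :: 'a set) - 1) ^ card A * card (UNIV :: 'a set) ^ (\<Sum>(i, j)\<in>A. j - i - 1)"
proof -
  let ?I = "{..<n} \<times> {..<n}" and ?F = "\<lambda>c. \<lambda>X\<in>strict_upper n. pairing n p (c * X)"
  define S :: "nat \<times> nat \<Rightarrow> 'a set" where
    "S ij = (if ij \<in> slots then if fst ij = snd ij then UNIV - {0} else UNIV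
      else {of_bool (fst ij = snd ij)})" for ij
  define M where "M = {b \<in> carrier_mat n n. \<forall>ij\<in>?I. b $$ ij \<in> S ij}"
  have slots: "slots \<subseteq> ?I" "(i, k) \<in> slots \<Longrightarrow> i \<le> k" for i k
    by (auto simp: slots_def dest: arc_bound)
  have M_S: "b $$ (i, j) \<in> S (i, j)" if "b \<in> M" "i < n" "j < n" for b i j
    using that by (auto simp: M_def)
  have MB: "b \<in> B n" if b: "b \<in> M" for b
  proof -
    have "b $$ (i, j) = 0" if "j < i" "i < n" for i j
      using M_S[OF b, of i j] that slots(2)[of i j] by (auto simp: S_def split: if_splits)
    moreover have "b $$ (i, i) \<noteq> 0" if "i < n" for i
      using M_S[OF b, of i i] that by (auto simp: S_def split: if_splits)
    ultimately show ?thesis using b by (auto simp: borel_iff M_def upper_triangular_def)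
  qed
  have "inj_on ?F M"
  proof (rule inj_onI)
    fix b c assume *: "b \<in> M" "c \<in> M" "?F b = ?F c"
    have eq: "\<forall>ik\<in>slots. b $$ ik = c $$ ik"
      using *(3) left_translate_eq_iff[OF MB[OF *(1)] MB[OF *(2)]] unfolding p_def by blast
    show "b = c"
    proof (rule eq_matI)
      fix i j assume "i < dim_row c" "j < dim_col c"
      then have "i < n" "j < n" using *(2) by (auto simp: M_def)
      then show "b $$ (i, j) = c $$ (i, j)"
        using eq M_S[OF *(1), of i j] M_S[OF *(2), of i j]
        by (cases "(i, j) \<in> slots") (auto simp: S_def)
    qed (use * in \<open>auto simp: M_def\<close>)
  qed
  moreover have "?F ` M = ?F ` B n"
  proof
    show "?F ` M \<subseteq> ?F ` B n" using MB by blast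
    show "?F ` B n \<subseteq> ?F ` M"
    proof (rule image_subsetI)
      fix b :: "'a mat" assume b: "b \<in> B n"
      define c where "c = mat n n (\<lambda>ij. if ij \<in> slots then b $$ ij else of_bool (fst ij = snd ij))"
      have c: "c \<in> M" using b by (auto simp: M_def c_def S_def borel_iff)
      have "?F b = ?F c"
        using left_translate_eq_iff[OF b MB[OF c]] slots unfolding p_def by (auto simp: c_def)
      then show "?F b \<in> ?F ` M" using c by blast
    qed
  qed
  ultimately have "card (?F ` B n) = card M" by (metis card_image)
  also have "\<dots> = (\<Prod>ij\<in>?I. card (S ij))" unfolding M_def by (rule card_mat_entries)
  also have "\<dots> = (\<Prod>ij\<in>slots. (\<lambda>d. if d then card (UNIV :: 'a set) - 1 else card (UNIV :: 'a set)) (fst ij = snd ij))"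
    by (rule prod.mono_neutral_cong_right) (use slots in \<open>auto simp: S_def card_Diff_subset\<close>)
  also have "\<dots> = (card (UNIV :: 'a set) - 1) ^ card A * card (UNIV :: 'a set) ^ (\<Sum>(i, j)\<in>A. j - i - 1)"
    using prod_slots[of "\<lambda>d. if d then card (UNIV :: 'a set) - 1 else card (UNIV :: 'a set)"] by simp
  finally show ?thesis .
qed

text \<open>For an arc \<open>(i, j)\<close> and \<open>i < l < j\<close>, the functional \<open>L (_ v)\<close> has coefficient \<open>v (l, j)\<close> at \<open>(i, l)\<close>.
  A functional in the left orbit can only have a nonzero coefficient there if an arc \<open>(i', l)\<close>
  with \<open>i' < i\<close> provides it, that is, if some arc ending at \<open>l\<close> crosses \<open>(i, j)\<close>.\<close>

definition constraints :: "(nat \<times> nat) set" where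
  "constraints = {(l, j). \<exists>i. (i, j) \<in> A \<and> i < l \<and> l < j \<and> (\<forall>i'<i. (i', l) \<notin> A)}"

text \<open>Conversely, let the constraints hold. The equation at \<open>(k, l)\<close> for an arc
  \<open>(i, l)\<close> with \<open>i < k\<close> prescribes the entry \<open>c $$ (i, k)\<close>,
  and by \<open>right_unique\<close> no other equation does. For \<open>i = k\<close> both sides are
  1, and in the remaining equations both sides are 0.\<close>

lemma right_translate_iff:
  fixes v :: "'a::{finite,field} mat"
  assumes v: "v \<in> U n"
  defines "p \<equiv> \<lambda>i j. of_bool ((i, j) \<in> A) :: 'a"
  shows "(\<exists>c\<in>B n. \<forall>X\<in>strict_upper n. pairing n p (X * v) = pairing n p (c * X))
    \<longleftrightarrow> (\<forall>lj\<in>constraints. v $$ lj = 0)"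
proof -
  have ex: "(\<forall>X\<in>strict_upper n. pairing n p (X * v) = pairing n p (c * X))
    \<longleftrightarrow> (\<forall>l<n. \<forall>k<l. (\<Sum>j<n. p k j * v $$ (l, j)) = (\<Sum>i<n. c $$ (i, k) * p i l))"
    if "c \<in> B n" for c
    unfolding pairing_eq_iff[symmetric]
    by (simp add: pairing_mult_left[OF borel_carrier[OF that] strict_upper_carrier]
        pairing_mult_right[OF unitri_carrier[OF v] strict_upper_carrier])
  have v0: "v $$ (i, j) = 0" if "j < i" "i < n" for i j
    using v that by (auto simp: unitri_iff upper_triangular_def)
  show ?thesis
  proof
    assume "\<exists>c\<in>B n. \<forall>X\<in>strict_upper n. pairing n p (X * v) = pairing n p (c * X)"
    then obtain c where c: "c \<in> B n"
      and eq: "\<And>k l. l < n \<Longrightarrow> k < l \<Longrightarrow> (\<Sum>j<n. p k j * v $$ (l, j)) = (\<Sum>i<n. c $$ (i, k) * p i l)"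
      using ex by auto
    show "\<forall>lj\<in>constraints. v $$ lj = 0"
    proof
      fix lj assume "lj \<in> constraints"
      then obtain i l j where *: "lj = (l, j)" "(i, j) \<in> A" "i < l" "l < j" "\<forall>i'<i. (i', l) \<notin> A"
        by (auto simp: constraints_def)
      have ln: "l < n" using * arc_bound by fastforce
      have "v $$ (l, j) = (\<Sum>j<n. p i j * v $$ (l, j))"
        unfolding p_def by (rule sum_right_arc[OF *(2), symmetric])
      also have "\<dots> = (\<Sum>i'<n. c $$ (i', i) * p i' l)" by (rule eq[OF ln *(3)])
      \<comment> \<open>Arcs from \<open>i' < i\<close> to \<open>l\<close> are excluded by the
        constraint, \<open>i' = i\<close> by \<open>right_unique\<close> because
        \<open>l < j\<close>, and for \<open>i' > i\<close> the entry of \<open>c\<close> is below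
        the diagonal.\<close>
      also have "\<dots> = 0"
      proof (rule sum.neutral, rule ballI)
        fix i' assume i': "i' \<in> {..<n}"
        have "(i, l) \<notin> A" using * right_unique by blast
        then show "c $$ (i', i) * p i' l = 0"
          using * c i' by (cases i' i rule: linorder_cases) (auto simp: p_def borel_iff upper_triangular_def)
      qed
      finally show "v $$ lj = 0" by (simp add: *)
    qed
  next
    assume T: "\<forall>lj\<in>constraints. v $$ lj = 0"
    \<comment> \<open>The outer sum has at most one nonzero term: it looks up the end
      \<open>l\<close> of the arc starting at \<open>i\<close> and enters the coefficient of the
      right translate at \<open>(k, l)\<close>.\<close>
    define c where "c = mat n n (\<lambda>(i, k). if i < k
      then \<Sum>l<n. of_bool ((i, l) \<in> A) * (\<Sum>j<n. p k j * v $$ (l, j)) else of_bool (i = k))"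
    have c: "c \<in> B n" by (auto simp: c_def borel_iff upper_triangular_def)
    \<comment> \<open>An arc \<open>(k, j)\<close> has \<open>j \<noteq> l\<close>. If
      \<open>l < j\<close>, then \<open>(l, j)\<close> is a constraint; if \<open>j < l\<close>, it
      lies below the diagonal of \<open>v\<close>.\<close>
    have zero: "(\<Sum>j<n. p k j * v $$ (l, j)) = 0" if l: "l < n" "k < l" "\<forall>i\<le>k. (i, l) \<notin> A" for k l
    proof (rule sum.neutral, rule ballI)
      fix j assume j: "j \<in> {..<n}"
      show "p k j * v $$ (l, j) = 0"
      proof (cases "(k, j) \<in> A")
        case True
        then have "j \<noteq> l" using l by auto
        moreover have "(l, j) \<in> constraints" if "l < j"
          using True l that by (auto simp: constraints_def)
        ultimately have "v $$ (l, j) = 0" using v0[of j l] T l by (cases j l rule: linorder_cases) auto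
        then show ?thesis by simp
      qed (simp add: p_def)
    qed
    have "(\<Sum>j<n. p k j * v $$ (l, j)) = (\<Sum>i<n. c $$ (i, k) * p i l)" if l: "l < n" "k < l" for k l
    proof (cases "\<exists>i. (i, l) \<in> A")
      case True
      then obtain i where i: "(i, l) \<in> A" by blast
      have ik: "i < n" "k < n" using l arc_less[OF i] by auto
      have R: "(\<Sum>i<n. c $$ (i, k) * p i l) = c $$ (i, k)"
        unfolding p_def by (rule sum_left_arc[OF i])
      show ?thesis
      proof (cases i k rule: linorder_cases)
        case less
        then show ?thesis unfolding R using ik sum_right_arc[OF i, of "\<lambda>l. \<Sum>j<n. p k j * v $$ (l, j)"]
          by (simp add: c_def)
      next
        case equal
        then have "(\<Sum>j<n. p k j * v $$ (l, j)) = v $$ (l, l)"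
          unfolding p_def using sum_right_arc[of k l] i by simp
        then show ?thesis unfolding R using equal ik v l by (simp add: c_def unitri_iff)
      next
        case greater
        then have "\<forall>i\<le>k. (i, l) \<notin> A" using left_unique[OF i] not_le by blast
        then show ?thesis unfolding R using zero[OF l] greater ik by (simp add: c_def)
      qed
    next
      case False
      then have "(\<Sum>i<n. c $$ (i, k) * p i l) = 0" by (auto simp: p_def intro!: sum.neutral)
      then show ?thesis using zero[OF l] False by simp
    qed
    then show "\<exists>c\<in>B n. \<forall>X\<in>strict_upper n. pairing n p (X * v) = pairing n p (c * X)"
      using ex[OF c] c by blast
  qed
qed

text \<open>A position \<open>(l, j)\<close> with \<open>l\<close> strictly inside an arc
  \<open>(i, j)\<close> fails to be a constraint exactly when some arc \<open>(i', l)\<close> with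
  \<open>i' < i\<close> crosses \<open>(i, j)\<close>. By \<open>left_unique\<close> the two right
  ends determine the crossing.\<close>

lemma card_constraints:
  "card constraints + card {((i, j), (k, l)) \<in> A \<times> A. i < k \<and> k < j \<and> j < l} = (\<Sum>(i, j)\<in>A. j - i - 1)"
proof -
  let ?W = "{(l, j). \<exists>i. (i, j) \<in> A \<and> i < l \<and> l < j}"
  let ?C = "{((i, j), (k, l)) \<in> A \<times> A. i < k \<and> k < j \<and> j < l}"
  have W: "?W = (\<lambda>x. (snd x, snd (fst x))) ` (SIGMA ij:A. {fst ij<..<snd ij})"
    by force
  have fin: "finite ?W" unfolding W using finite_arcs by auto
  have "inj_on (\<lambda>x. (snd x, snd (fst x))) (SIGMA ij:A. {fst ij<..<snd ij})"
    by (auto simp: inj_on_def dest: left_unique)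
  then have "card ?W = (\<Sum>(i, j)\<in>A. j - i - 1)"
    unfolding W using finite_arcs by (simp add: card_image case_prod_beta)
  moreover have sub: "constraints \<subseteq> ?W" by (auto simp: constraints_def)
  moreover have "card ?C = card (?W - constraints)"
  proof -
    have inj: "inj_on (\<lambda>x. (snd (fst x), snd (snd x))) ?C"
      by (auto simp: inj_on_def dest: left_unique)
    have image: "(\<lambda>x. (snd (fst x), snd (snd x))) ` ?C = ?W - constraints"
    proof
      show "(\<lambda>x. (snd (fst x), snd (snd x))) ` ?C \<subseteq> ?W - constraints"
        by (auto simp: constraints_def dest: left_unique)
      show "?W - constraints \<subseteq> (\<lambda>x. (snd (fst x), snd (snd x))) ` ?C"
      proof
        fix x assume "x \<in> ?W - constraints"
        then obtain l j i where x: "x = (l, j)" "(i, j) \<in> A" "i < l" "l < j" "(l, j) \<notin> constraints"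
          by auto
        then obtain i' where "i' < i" "(i', l) \<in> A" by (auto simp: constraints_def)
        then have "((i', l), (i, j)) \<in> ?C" using x by auto
        then show "x \<in> (\<lambda>x. (snd (fst x), snd (snd x))) ` ?C" using x(1) by force
      qed
    qed
    show ?thesis using card_image[OF inj] unfolding image by (rule sym)
  qed
  ultimately show ?thesis
    using card_Diff_subset[OF finite_subset[OF sub fin] sub] card_mono[OF fin sub] by simp
qed

lemma constraints_subset: "constraints \<subseteq> {(l, j). l < j \<and> j < n}"
  by (auto simp: constraints_def dest: arc_bound)

end

section \<open>Arcs of set partitions\<close>

text \<open>Passage to matrix indices. Truncated subtraction does no harm on arcs, whose ends are at
  least 1.\<close>

definition shift_arc :: "nat \<times> nat \<Rightarrow> nat \<times> nat" where
  "shift_arc = (\<lambda>(i, j). (i - 1, j - 1))"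

lemma shift_arc_pair: "shift_arc (i, j) = (i - 1, j - 1)"
  by (simp add: shift_arc_def)

context
  fixes n :: nat and \<pi> :: "nat set set"
  assumes part: "partition_on {1..n} \<pi>"
begin

lemma arc_range: "(i, j) \<in> arcs \<pi> \<Longrightarrow> 1 \<le> i \<and> i < j \<and> j \<le> n"
  using partition_onD1[OF part] by (auto simp: arcs_def)

lemma same_block: "C \<in> \<pi> \<Longrightarrow> C' \<in> \<pi> \<Longrightarrow> x \<in> C \<Longrightarrow> x \<in> C' \<Longrightarrow> C = C'"
  using partition_onD2[OF part] by (auto simp: disjoint_def)

lemma arc_right_unique:
  assumes "(i, j) \<in> arcs \<pi>" "(i, j') \<in> arcs \<pi>"
  shows "j = j'"
proof -
  obtain C C' where "i < j" "C \<in> \<pi>" "i \<in> C" "j \<in> C" "\<forall>k. i < k \<and> k < j \<longrightarrow> k \<notin> C"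
    and "i < j'" "C' \<in> \<pi>" "i \<in> C'" "j' \<in> C'" "\<forall>k. i < k \<and> k < j' \<longrightarrow> k \<notin> C'"
    using assms by (auto simp: arcs_def)
  moreover from this have "C = C'" using same_block by blast
  ultimately show ?thesis by (metis linorder_neqE_nat)
qed

lemma arc_left_unique:
  assumes "(i, j) \<in> arcs \<pi>" "(i', j) \<in> arcs \<pi>"
  shows "i = i'"
proof -
  obtain C C' where "i < j" "C \<in> \<pi>" "i \<in> C" "j \<in> C" "\<forall>k. i < k \<and> k < j \<longrightarrow> k \<notin> C"
    and "i' < j" "C' \<in> \<pi>" "i' \<in> C'" "j \<in> C'" "\<forall>k. i' < k \<and> k < j \<longrightarrow> k \<notin> C'"
    using assms by (auto simp: arcs_def)
  moreover from this have "C = C'" using same_block by blast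
  ultimately show ?thesis by (metis linorder_neqE_nat)
qed

lemma inj_shift_arc: "inj_on shift_arc (arcs \<pi>)"
proof (rule inj_onI)
  fix x y assume "x \<in> arcs \<pi>" "y \<in> arcs \<pi>" "shift_arc x = shift_arc y"
  then show "x = y"
    using arc_range[of "fst x" "snd x"] arc_range[of "fst y" "snd y"]
    by (cases x; cases y) (auto simp: shift_arc_def)
qed

lemma arc_diagram_shift: "arc_diagram n (shift_arc ` arcs \<pi>)"
proof -
  have arc: "(Suc i, Suc j) \<in> arcs \<pi>" if ij: "(i, j) \<in> shift_arc ` arcs \<pi>" for i j
  proof -
    obtain x where "x \<in> arcs \<pi>" "(i, j) = shift_arc x" using ij by blast
    then show ?thesis using arc_range[of "fst x" "snd x"] by (cases x) (auto simp: shift_arc_def)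
  qed
  show ?thesis
  proof
    fix i j assume ij: "(i, j) \<in> shift_arc ` arcs \<pi>"
    show "i < j" "j < n" using arc_range[OF arc[OF ij]] by auto
    show "j = j'" if "(i, j') \<in> shift_arc ` arcs \<pi>" for j'
      using arc_right_unique[OF arc[OF ij] arc[OF that]] by simp
    show "i = i'" if "(i', j) \<in> shift_arc ` arcs \<pi>" for i'
      using arc_left_unique[OF arc[OF ij] arc[OF that]] by simp
  qed
qed

lemma card_shift_arcs: "card (shift_arc ` arcs \<pi>) = num_arcs \<pi>"
  by (simp add: card_image inj_shift_arc num_arcs_def)

text \<open>Arcs have length at least 1, so splitting 1 off each length is exact in
  \<open>nat\<close>; what remains is the exponent \<open>dim - d\<close>.\<close>

lemma shifted_arc_lengths:
  "(\<Sum>(i, j)\<in>shift_arc ` arcs \<pi>. j - i - 1) + num_arcs \<pi> = arc_dim \<pi>"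
proof -
  have "(\<Sum>(i, j)\<in>shift_arc ` arcs \<pi>. j - i - 1) = (\<Sum>(i, j)\<in>arcs \<pi>. j - i - 1)"
    unfolding sum.reindex[OF inj_shift_arc] o_def
    by (intro sum.cong refl) (auto simp: shift_arc_def dest: arc_range)
  moreover have "(\<Sum>(i, j)\<in>arcs \<pi>. j - i - 1) + (\<Sum>(i, j)\<in>arcs \<pi>. 1) = arc_dim \<pi>"
    unfolding arc_dim_def sum.distrib[symmetric]
    by (intro sum.cong refl) (auto dest: arc_range)
  ultimately show ?thesis by (simp add: num_arcs_def case_prod_beta)
qed

lemma card_shifted_crossings:
  "card {((i, j), (k, l)) \<in> shift_arc ` arcs \<pi> \<times> shift_arc ` arcs \<pi>. i < k \<and> k < j \<and> j < l} = crs \<pi>"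
proof -
  let ?C = "{((i, j), (k, l)) \<in> arcs \<pi> \<times> arcs \<pi>. i < k \<and> k < j \<and> j < l}"
  have "{((i, j), (k, l)) \<in> shift_arc ` arcs \<pi> \<times> shift_arc ` arcs \<pi>. i < k \<and> k < j \<and> j < l}
      = map_prod shift_arc shift_arc ` ?C"
  proof (rule equalityI; rule subsetI)
    fix x assume "x \<in> {((i, j), (k, l)) \<in> shift_arc ` arcs \<pi> \<times> shift_arc ` arcs \<pi>. i < k \<and> k < j \<and> j < l}"
    then obtain i j k l where *: "(i, j) \<in> arcs \<pi>" "(k, l) \<in> arcs \<pi>" "x = (shift_arc (i, j), shift_arc (k, l))"
      "i - 1 < k - 1" "k - 1 < j - 1" "j - 1 < l - 1"
      by (auto simp: shift_arc_def)
    then have "((i, j), (k, l)) \<in> ?C" by auto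
    then show "x \<in> map_prod shift_arc shift_arc ` ?C" by (rule rev_image_eqI) (simp add: *)
  next
    fix x assume "x \<in> map_prod shift_arc shift_arc ` ?C"
    then obtain i j k l where *: "(i, j) \<in> arcs \<pi>" "(k, l) \<in> arcs \<pi>" "x = (shift_arc (i, j), shift_arc (k, l))"
      "i < k" "k < j" "j < l" by auto
    then show "x \<in> {((i, j), (k, l)) \<in> shift_arc ` arcs \<pi> \<times> shift_arc ` arcs \<pi>. i < k \<and> k < j \<and> j < l}"
      using arc_range[OF *(1)] arc_range[OF *(2)] imageI[OF *(1), of shift_arc] imageI[OF *(2), of shift_arc]
        *(4-6) unfolding *(3) shift_arc_pair by (simp, arith)
  qed
  moreover have "inj_on (map_prod shift_arc shift_arc) ?C"
    by (rule inj_on_subset[OF map_prod_inj_on[OF inj_shift_arc inj_shift_arc]]) auto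
  \<comment> \<open>The condition \<open>i < k\<close> orders the two arcs of a crossing, so each
    unordered pair comes from one ordered pair.\<close>
  moreover have "inj_on (\<lambda>(x, y). {x, y}) ?C" by (auto simp: inj_on_def doubleton_eq_iff)
  moreover have "(\<lambda>(x, y). {x, y}) ` ?C = {{(i, j), (k, l)} | i j k l.
      (i, j) \<in> arcs \<pi> \<and> (k, l) \<in> arcs \<pi> \<and> i < k \<and> k < j \<and> j < l}"
    by (auto simp: image_iff)
  ultimately show ?thesis by (metis (no_types, lifting) card_image crs_def)
qed

lemma arc_functional_eq_pairing:
  "arc_functional n \<pi> = (\<lambda>X\<in>strict_upper n. pairing n (\<lambda>i j. of_bool ((i, j) \<in> shift_arc ` arcs \<pi>)) X)"
  unfolding arc_functional_def
proof (rule restrict_ext)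
  fix X :: "'a::field mat"
  let ?A = "shift_arc ` arcs \<pi>"
  have sub: "?A \<subseteq> {..<n} \<times> {..<n}" by (auto simp: shift_arc_def dest: arc_range)
  have "pairing n (\<lambda>i j. of_bool ((i, j) \<in> ?A)) X = (\<Sum>ij\<in>{..<n} \<times> {..<n}. of_bool (ij \<in> ?A) * X $$ ij)"
    unfolding pairing_def sum.cartesian_product by (intro sum.cong refl) (simp only: case_prod_beta prod.collapse)
  also have "\<dots> = (\<Sum>ij\<in>?A. X $$ ij)"
    using sub by (intro sum.mono_neutral_cong_right) auto
  also have "\<dots> = (\<Sum>(i, j)\<in>arcs \<pi>. X $$ (i - 1, j - 1))"
    unfolding sum.reindex[OF inj_shift_arc] by (simp add: shift_arc_def case_prod_beta)
  finally show "(\<Sum>(i, j)\<in>arcs \<pi>. X $$ (i - 1, j - 1)) = pairing n (\<lambda>i j. of_bool ((i, j) \<in> ?A)) X" ..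
qed

text \<open>\<open>dual_action\<close> multiplies by the inverse of \<open>b\<close>,
  \<open>orbit\<close> by \<open>c\<close> itself; inversion permutes \<open>B n\<close>, so the
  images agree.\<close>

lemma arc_orbit_eq:
  "arc_orbit n \<pi> = pairing_orbit.orbit n (\<lambda>i j. of_bool ((i, j) \<in> shift_arc ` arcs \<pi>) :: 'a::{finite,field})"
proof -
  let ?p = "\<lambda>i j. of_bool ((i, j) \<in> shift_arc ` arcs \<pi>) :: 'a"
  let ?F = "\<lambda>c. \<lambda>X\<in>strict_upper n. pairing n ?p (c * X)"
  have "dual_action n b (arc_functional n \<pi>) = ?F (inv\<^bsub>borel_group n\<^esub> b)" if "b \<in> B n" for b :: "'a mat"
    unfolding dual_action_def arc_functional_eq_pairing
    using group.inv_closed[OF group_borel that]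
    by (intro restrict_ext) (simp add: borel_mult_strict_upper)
  then have "arc_orbit n \<pi> = ?F ` (\<lambda>b. inv\<^bsub>borel_group n\<^esub> b) ` B n"
    unfolding arc_orbit_def image_image by (intro image_cong refl)
  moreover have "(\<lambda>b. inv\<^bsub>borel_group n\<^esub> b) ` B n = (B n :: 'a mat set)"
  proof
    show "(\<lambda>b. inv\<^bsub>borel_group n\<^esub> b) ` B n \<subseteq> (B n :: 'a mat set)"
      using group.inv_closed[OF group_borel] by blast
    show "B n \<subseteq> (\<lambda>b. inv\<^bsub>borel_group n\<^esub> b) ` (B n :: 'a mat set)"
    proof
      fix b :: "'a mat" assume b: "b \<in> B n"
      show "b \<in> (\<lambda>b. inv\<^bsub>borel_group n\<^esub> b) ` B n"
        using group.inv_inv[OF group_borel b] group.inv_closed[OF group_borel b] by (metis image_eqI)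
    qed
  qed
  ultimately show ?thesis by (simp add: pairing_orbit.orbit_def)
qed

end

theorem corollary3p2:
  fixes q n :: nat
    and \<pi> :: "nat set set"
    and \<theta> :: "'a::{finite, field} \<Rightarrow> complex"
  assumes "card (UNIV :: 'a set) = q"
    and "n \<ge> 1"
    and "partition_on {1..n} \<pi>"
    and "nontrivial_additive_character \<theta>"
  shows "SPl (unitri_group n) (supercharacter \<theta> n \<pi>) =
           1 / of_nat q ^ (n * (n - 1) div 2) *
           ((of_nat q - 1) ^ num_arcs \<pi> * of_nat q powi (2 * int (arc_dim \<pi>) - 2 * int (num_arcs \<pi>))
             / of_nat q ^ crs \<pi>)"
proof -
  note q = assms(1) and part = assms(3) and \<theta> = assms(4)
  let ?A = "shift_arc ` arcs \<pi>"
  define p where "p = (\<lambda>i j. of_bool ((i, j) \<in> ?A) :: 'a)"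
  \<comment> \<open>\<open>D\<close> is \<open>dim - d\<close>, and \<open>E\<close> is the number
    of positions above the diagonal.\<close>
  define D where "D = (\<Sum>(i, j)\<in>?A. j - i - 1)"
  define E where "E = n * (n - 1) div 2"
  interpret arc_diagram n ?A by (rule arc_diagram_shift[OF part])
  interpret pairing_orbit n p .
  have q0: "q > 0" using q finite_UNIV_card_ge_0[where 'a = 'a] by simp
  have dim: "arc_dim \<pi> = D + num_arcs \<pi>" using shifted_arc_lengths[OF part] by (simp add: D_def)
  have orbit: "card orbit = (q - 1) ^ num_arcs \<pi> * q ^ D"
    using card_left_translates[where 'a = 'a] unfolding orbit_def p_def[symmetric] D_def
    by (simp add: card_shift_arcs[OF part] q)
  have "right_stable = {v \<in> U n. \<forall>lj\<in>constraints. v $$ lj = 0}"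
    unfolding right_stable_def using right_translate_iff[where 'a = 'a] unfolding p_def by blast
  then have "card right_stable * q ^ card constraints = q ^ E"
    using card_unitri_vanishing[OF constraints_subset, where 'a = 'a] by (simp add: q E_def)
  moreover have constr: "card constraints + crs \<pi> = D"
    using card_constraints card_shifted_crossings[OF part] by (simp add: D_def)
  \<comment> \<open>Multiplication by \<open>q ^ crs \<pi>\<close> completes the exponent
    \<open>card constraints\<close> to \<open>D\<close> and keeps the identity in
    \<open>nat\<close>.\<close>
  ultimately have "card right_stable * q ^ D = q ^ E * q ^ crs \<pi>"
    by (metis mult.assoc power_add)
  then have stable: "of_nat (card right_stable) = (of_nat q ^ E * of_nat q ^ crs \<pi> / of_nat q ^ D :: complex)"
    using q0 by (simp add: eq_divide_eq flip: of_nat_power of_nat_mult)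
  have "supercharacter \<theta> n \<pi> = (\<lambda>u. \<Sum>\<mu>\<in>orbit. module_entry \<theta> n u \<mu> \<mu>)"
    unfolding supercharacter_def arc_orbit_eq[OF part] p_def ..
  then have "SPl (unitri_group n) (supercharacter \<theta> n \<pi>) = of_nat (card orbit) / of_nat (card right_stable)"
    using SPl_orbit_character[OF \<theta>] by simp
  also have "\<dots> = (of_nat q - 1) ^ num_arcs \<pi> * of_nat q ^ (2 * D) / (of_nat q ^ E * of_nat q ^ crs \<pi>)"
    unfolding orbit stable using q0 by (simp add: of_nat_diff mult_2 power_add)
  \<comment> \<open>The integer exponent equals \<open>2 * D\<close>, so the integer power is an
    ordinary one.\<close>
  also have "of_nat q ^ (2 * D) = (of_nat q powi (2 * int (arc_dim \<pi>) - 2 * int (num_arcs \<pi>)) :: complex)"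
    unfolding power_int_of_nat[symmetric] dim by simp
  finally show ?thesis by (simp add: E_def)
qed

end
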